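(* Let $W_1,W_2,W$ be generalized $V$-modules, $z$ a nonzero complex number, and $F:W_1\otimes W_2\to W^*$ a linear map. Then $F$ is a $P(z)$-intertwining map of type $\binom{W'}{W_1\,W_2}$ if and only if $F(W_1\otimes W_2)\subset\mathcal D_{P(z)}(W)$ and $F$ is a $V\otimes V$-homomorphism from $W_1\otimes W_2$ to $(\mathcal D_{P(z)}(W),Y_{P(z)})$. Equivalently, the space of $P(z)$-intertwining maps of type $\binom{W'}{W_1\,W_2}$ equals $\mathrm{Hom}_{V\otimes V}(W_1\otimes W_2,\mathcal D_{P(z)}(W))$.
   Context: $V$ is a vertex operator algebra with vacuum $\mathbf 1$, Virasoro element $\omega$, $Y(\omega,x)=\sum_{n}L(n)x^{-n-2}$; $V\otimes V$ is the tensor product vertex operator algebra with $Y(u\otimes v,x)=Y(u,x)\otimes Y(v,x)$. The formal delta function is $\delta(x)=\sum_{n\in\mathbb Z}x^n$; binomial expressions $(x_1-x_2)^n$ are expanded in nonnegative powers of the second variable. A weak $V$-module is a vector space $W$ with $Y_W:V\to(\mathrm{End}\,W)[[x,x^{-1}]]$ such that $Y_W(v,x)w\in W((x))$, $Y_W(\mathbf 1,x)=\mathrm{id}$, and the Jacobi identity $x_0^{-1}\delta(\frac{x_1-x_2}{x_0})Y_W(u,x_1)Y_W(v,x_2)-x_0^{-1}\delta(\frac{x_2-x_1}{-x_0})Y_W(v,x_2)Y_W(u,x_1)=x_2^{-1}\delta(\frac{x_1-x_0}{x_2})Y_W(Y(u,x_0)v,x_2)$ holds. A generalized $V$-module is a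 weak $V$-module $W=\coprod_{h\in\mathbb C}W_{(h)}$ on which $L(0)$ acts semisimply ($W_{(h)}$ the $h$-eigenspace). For generalized modules $W_1,W_2$, $W_1\otimes W_2$ is a weak $V\otimes V$-module via $Y(u\otimes v,x)=Y_{W_1}(u,x)\otimes Y_{W_2}(v,x)$. The restricted dual is $W'=\coprod_h W_{(h)}^*$, so $W^*=\prod_hW_{(h)}^*$. For $v\in V$ set $Y^o(v,x)=Y_W(e^{xL(1)}(-x^{-2})^{L(0)}v,x^{-1})$, and for $\alpha\in W^*$ define $Y^*(v,x)\alpha\in W^*[[x,x^{-1}]]$ by $\langle Y^*(v,x)\alpha,w\rangle=\langle\alpha,Y^o(v,x)w\rangle$. A $P(z)$-intertwining map of type $\binom{W'}{W_1\,W_2}$ is a linear map $F:W_1\otimes W_2\to W^*$ such that for all $v\in V$, $w_{(1)}\in W_1$, $w_{(2)}\in W_2$: $x_0^{-1}\delta(\frac{x_1-z}{x_0})Y^*(v,x_1)F(w_{(1)}\otimes w_{(2)})-x_0^{-1}\delta(\frac{z-x_1}{-x_0})F(w_{(1)}\otimes Y(v,x_1)w_{(2)})=z^{-1}\delta(\frac{x_1-x_0}{z})F(Y(v,x_0)w_{(1)}\otimes w_{(2)})$. An element $\alpha\in W^*$ is a $P(z)$-linear functional if for all $v\in V,w\in W$ the series $\langle\alpha,Y^o(v,x)w\rangle$ converges absolutely in $|x|>|z|$ to a rational function in $\mathbb C[x,x^{-1},(x-z)^{-1}]$, with pole orders at $0$ and $z$ bounded independently of $w$ for fixed $v$; $\mathcal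 D_{P(z)}(W)$ is the space of these. With $\iota_{x;\infty},\iota_{x;0}$ the Laurent expansion maps of rational functions at $x=\infty$ and $x=0$, and $f_{v,\alpha,w}=\iota_{x;\infty}^{-1}\langle\alpha,Y^o(v,x)w\rangle$, define $\langle Y^R_{P(z)}(v,x)\alpha,w\rangle=\iota_{x;0}f_{v,\alpha,w}(x)$, $\langle Y^L_{P(z)}(v,x)\alpha,w\rangle=\iota_{x;0}\big(f_{v,\alpha,w}(x+z)\big)$, and $Y_{P(z)}(u\otimes v,x)=Y^L_{P(z)}(u,x)Y^R_{P(z)}(v,x)$; $(\mathcal D_{P(z)}(W),Y_{P(z)})$ is a weak $V\otimes V$-module. *)

theory Defs
  imports "HOL-Analysis.Analysis" "HOL-Computational_Algebra.Polynomial"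
begin

text \<open>Conventions.  A formal series is represented by its coefficient function:
  for a vertex operator map Y (of V or of a module), Y u n w is the coefficient
  of x^n in Y(u,x)w, so that u_m = Y u (-m-1) and L(m) = Y omega (-m-2).
  Vector spaces over the complex numbers are given by an abelian group type together with a
  scalar multiplication satisfying the vector_space axioms of Main.
  The algebraic dual W^* = prod_h W_(h)^* is the space of all linear functionals on W,
  represented as functions of type w => complex.\<close>

definition fsum :: "('i \<Rightarrow> 'a::comm_monoid_add) \<Rightarrow> 'a" where
  "fsum f = sum f {i. f i \<noteq> 0}"

definition lower_trunc :: "(int \<Rightarrow> 'a::zero) \<Rightarrow> bool" where
  "lower_trunc f \<longleftrightarrow> (\<exists>N. \<forall>n<N. f n = 0)"

text \<open>Jacobi identity, written out coefficientwise: the coefficient of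
  x0^a x1^b x2^c of the three terms, with the binomial expansions in nonnegative powers
  of the second variable.\<close>
definition jacobi_identity ::
  "(complex \<Rightarrow> 'w::ab_group_add \<Rightarrow> 'w) \<Rightarrow> ('v \<Rightarrow> int \<Rightarrow> 'v \<Rightarrow> 'v) \<Rightarrow>
   ('v \<Rightarrow> int \<Rightarrow> 'w \<Rightarrow> 'w) \<Rightarrow> bool" where
  "jacobi_identity sW Y act \<longleftrightarrow> (\<forall>u v w a b c.
     fsum (\<lambda>i::nat. sW ((of_int (-a-1) gchoose i) * (-1)^i)
                        (act u (a + b + 1 + int i) (act v (c - int i) w)))
   - sW ((-1) powi (a+1))
       (fsum (\<lambda>i::nat. sW ((of_int (-a-1) gchoose i) * (-1)^i)
                        (act v (c + a + 1 + int i) (act u (b - int i) w))))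
   = fsum (\<lambda>i::nat. sW ((of_int (b + int i) gchoose i) * (-1)^i)
                        (act (Y u (a - int i) v) (c + b + 1 + int i) w)))"

definition Lop :: "('v \<Rightarrow> int \<Rightarrow> 'x \<Rightarrow> 'x) \<Rightarrow> 'v \<Rightarrow> int \<Rightarrow> 'x \<Rightarrow> 'x" where
  "Lop act \<omega> m = act \<omega> (-m-2)"

definition wt_space :: "(complex \<Rightarrow> 'v \<Rightarrow> 'v) \<Rightarrow> ('v \<Rightarrow> int \<Rightarrow> 'v \<Rightarrow> 'v) \<Rightarrow> 'v \<Rightarrow> int \<Rightarrow> 'v set" where
  "wt_space sV Y \<omega> n = {v. Lop Y \<omega> 0 v = sV (of_int n) v}"

definition VOA :: "(complex \<Rightarrow> 'v::ab_group_add \<Rightarrow> 'v) \<Rightarrow> ('v \<Rightarrow> int \<Rightarrow> 'v \<Rightarrow> 'v) \<Rightarrow> 'v \<Rightarrow> 'v \<Rightarrow> bool" where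
  "VOA sV Y vac \<omega> \<longleftrightarrow> vector_space sV \<and>
     (\<forall>n v. Vector_Spaces.linear sV sV (\<lambda>u. Y u n v)) \<and>
     (\<forall>u n. Vector_Spaces.linear sV sV (Y u n)) \<and>
     (\<forall>u v. lower_trunc (\<lambda>n. Y u n v)) \<and>
     (\<forall>n v. Y vac n v = (if n = 0 then v else 0)) \<and>
     (\<forall>v. (\<forall>n<0. Y v n vac = 0) \<and> Y v 0 vac = v) \<and>
     jacobi_identity sV Y Y \<and>
     (\<forall>v. \<exists>S g. finite S \<and> (\<forall>n\<in>S. g n \<in> wt_space sV Y \<omega> n) \<and> v = sum g S) \<and>
     (\<forall>n. \<exists>B. finite B \<and> wt_space sV Y \<omega> n \<subseteq> module.span sV B) \<and>
     (\<exists>N. \<forall>n<N. wt_space sV Y \<omega> n = {0}) \<and>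
     (\<exists>c::complex. \<forall>m n v.
        Lop Y \<omega> m (Lop Y \<omega> n v) - Lop Y \<omega> n (Lop Y \<omega> m v)
        = sV (of_int (m - n)) (Lop Y \<omega> (m + n) v)
          + sV (if m + n = 0 then c * of_int (m^3 - m) / 12 else 0) v) \<and>
     (\<forall>v n w. Y (Lop Y \<omega> (-1) v) n w = sV (of_int (n + 1)) (Y v (n + 1) w)) \<and>
     \<omega> \<in> wt_space sV Y \<omega> 2 \<and> vac \<in> wt_space sV Y \<omega> 0"

definition weak_module ::
  "(complex \<Rightarrow> 'v::ab_group_add \<Rightarrow> 'v) \<Rightarrow> ('v \<Rightarrow> int \<Rightarrow> 'v \<Rightarrow> 'v) \<Rightarrow> 'v \<Rightarrow>
   (complex \<Rightarrow> 'w::ab_group_add \<Rightarrow> 'w) \<Rightarrow> ('v \<Rightarrow> int \<Rightarrow> 'w \<Rightarrow> 'w) \<Rightarrow> bool" where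
  "weak_module sV Y vac sW act \<longleftrightarrow> vector_space sW \<and>
     (\<forall>n w. Vector_Spaces.linear sV sW (\<lambda>u. act u n w)) \<and>
     (\<forall>u n. Vector_Spaces.linear sW sW (act u n)) \<and>
     (\<forall>u w. lower_trunc (\<lambda>n. act u n w)) \<and>
     (\<forall>n w. act vac n w = (if n = 0 then w else 0)) \<and>
     jacobi_identity sW Y act"

definition gen_module ::
  "(complex \<Rightarrow> 'v::ab_group_add \<Rightarrow> 'v) \<Rightarrow> ('v \<Rightarrow> int \<Rightarrow> 'v \<Rightarrow> 'v) \<Rightarrow> 'v \<Rightarrow> 'v \<Rightarrow>
   (complex \<Rightarrow> 'w::ab_group_add \<Rightarrow> 'w) \<Rightarrow> ('v \<Rightarrow> int \<Rightarrow> 'w \<Rightarrow> 'w) \<Rightarrow> bool" where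
  "gen_module sV Y vac \<omega> sW act \<longleftrightarrow> weak_module sV Y vac sW act \<and>
     (\<forall>w. \<exists>(S::complex set) g. finite S \<and>
        (\<forall>h\<in>S. Lop act \<omega> 0 (g h) = sW h (g h)) \<and> w = sum g S)"

definition hcomp :: "(complex \<Rightarrow> 'v::ab_group_add \<Rightarrow> 'v) \<Rightarrow> ('v \<Rightarrow> int \<Rightarrow> 'v \<Rightarrow> 'v) \<Rightarrow> 'v \<Rightarrow> int \<Rightarrow> 'v \<Rightarrow> 'v" where
  "hcomp sV Y \<omega> n v = (THE u. u \<in> wt_space sV Y \<omega> n \<and>
     (\<exists>S g. finite S \<and> n \<notin> S \<and> (\<forall>m\<in>S. g m \<in> wt_space sV Y \<omega> m) \<and> v = u + sum g S))"

text \<open>Coefficient of x^j in Y^o(v,x)w = Y_W(e^{xL(1)}(-x^{-2})^{L(0)}v, x^{-1})w.\<close>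
definition Yo :: "(complex \<Rightarrow> 'v::ab_group_add \<Rightarrow> 'v) \<Rightarrow> ('v \<Rightarrow> int \<Rightarrow> 'v \<Rightarrow> 'v) \<Rightarrow> 'v \<Rightarrow>
   (complex \<Rightarrow> 'w::ab_group_add \<Rightarrow> 'w) \<Rightarrow> ('v \<Rightarrow> int \<Rightarrow> 'w \<Rightarrow> 'w) \<Rightarrow> 'v \<Rightarrow> int \<Rightarrow> 'w \<Rightarrow> 'w" where
  "Yo sV Y \<omega> sW act v j w = fsum (\<lambda>n::int. fsum (\<lambda>k::nat.
      sW ((-1::complex) powi n / of_nat (fact k))
         (act ((Lop Y \<omega> 1 ^^ k) (hcomp sV Y \<omega> n v)) (int k - 2 * n - j) w)))"

definition lin_functional :: "(complex \<Rightarrow> 'w \<Rightarrow> 'w::ab_group_add) \<Rightarrow> ('w \<Rightarrow> complex) \<Rightarrow> bool" where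
  "lin_functional sW \<alpha> \<longleftrightarrow> (\<forall>w w'. \<alpha> (w + w') = \<alpha> w + \<alpha> w') \<and> (\<forall>c w. \<alpha> (sW c w) = c * \<alpha> w)"

text \<open>F : W1 (x) W2 -> W^*, represented (universal property of the tensor product)
  as a bilinear map W1 x W2 -> W^*.\<close>
definition bilinear_to_dual ::
  "(complex \<Rightarrow> 'w1::ab_group_add \<Rightarrow> 'w1) \<Rightarrow> (complex \<Rightarrow> 'w2::ab_group_add \<Rightarrow> 'w2) \<Rightarrow>
   (complex \<Rightarrow> 'w::ab_group_add \<Rightarrow> 'w) \<Rightarrow> ('w1 \<Rightarrow> 'w2 \<Rightarrow> 'w \<Rightarrow> complex) \<Rightarrow> bool" where
  "bilinear_to_dual s1 s2 sW F \<longleftrightarrow>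
     (\<forall>w1 w2. lin_functional sW (F w1 w2)) \<and>
     (\<forall>a b w2. F (a + b) w2 = (\<lambda>w. F a w2 w + F b w2 w)) \<and>
     (\<forall>c a w2. F (s1 c a) w2 = (\<lambda>w. c * F a w2 w)) \<and>
     (\<forall>w1 a b. F w1 (a + b) = (\<lambda>w. F w1 a w + F w1 b w)) \<and>
     (\<forall>w1 c a. F w1 (s2 c a) = (\<lambda>w. c * F w1 a w))"

text \<open>P(z)-intertwining map: the Jacobi identity paired with an arbitrary w in W,
  coefficient of x0^a x1^b.\<close>
definition P_intertwining ::
  "(complex \<Rightarrow> 'v::ab_group_add \<Rightarrow> 'v) \<Rightarrow> ('v \<Rightarrow> int \<Rightarrow> 'v \<Rightarrow> 'v) \<Rightarrow> 'v \<Rightarrow>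
   (complex \<Rightarrow> 'w1::ab_group_add \<Rightarrow> 'w1) \<Rightarrow> ('v \<Rightarrow> int \<Rightarrow> 'w1 \<Rightarrow> 'w1) \<Rightarrow>
   (complex \<Rightarrow> 'w2::ab_group_add \<Rightarrow> 'w2) \<Rightarrow> ('v \<Rightarrow> int \<Rightarrow> 'w2 \<Rightarrow> 'w2) \<Rightarrow>
   (complex \<Rightarrow> 'w::ab_group_add \<Rightarrow> 'w) \<Rightarrow> ('v \<Rightarrow> int \<Rightarrow> 'w \<Rightarrow> 'w) \<Rightarrow>
   complex \<Rightarrow> ('w1 \<Rightarrow> 'w2 \<Rightarrow> 'w \<Rightarrow> complex) \<Rightarrow> bool" where
  "P_intertwining sV Y \<omega> s1 act1 s2 act2 sW act z F \<longleftrightarrow>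
    (\<forall>v w1 w2 w a b.
       fsum (\<lambda>i::nat. (of_int (-a-1) gchoose i) * (-z)^i
                       * F w1 w2 (Yo sV Y \<omega> sW act v (b + a + 1 + int i) w))
     - (-1) powi (a+1) * fsum (\<lambda>i::nat. (of_int (-a-1) gchoose i) * z powi (-a-1-int i) * (-1)^i
                       * F w1 (act2 v (b - int i) w2) w)
     = fsum (\<lambda>i::nat. z powi (-b - int i - 1) * (of_int (b + int i) gchoose i) * (-1)^i
                       * F (act1 v (a - int i) w1) w2 w))"

definition conv_at_inf :: "complex \<Rightarrow> (int \<Rightarrow> complex) \<Rightarrow> (complex \<Rightarrow> complex) \<Rightarrow> bool" where
  "conv_at_inf z c f \<longleftrightarrow> (\<forall>x. norm x > norm z \<longrightarrow>
     (\<lambda>n. norm (c n * x powi n)) summable_on UNIV \<and> ((\<lambda>n. c n * x powi n) has_sum f x) UNIV)"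

text \<open>The elements of C[x,x^{-1},(x-z)^{-1}] with pole orders at 0 and z at most N.\<close>
definition rat_fun :: "complex \<Rightarrow> nat \<Rightarrow> complex poly \<Rightarrow> complex \<Rightarrow> complex" where
  "rat_fun z N p = (\<lambda>x. poly p x / (x ^ N * (x - z) ^ N))"

definition D_Pz ::
  "(complex \<Rightarrow> 'v::ab_group_add \<Rightarrow> 'v) \<Rightarrow> ('v \<Rightarrow> int \<Rightarrow> 'v \<Rightarrow> 'v) \<Rightarrow> 'v \<Rightarrow>
   (complex \<Rightarrow> 'w::ab_group_add \<Rightarrow> 'w) \<Rightarrow> ('v \<Rightarrow> int \<Rightarrow> 'w \<Rightarrow> 'w) \<Rightarrow> complex \<Rightarrow> ('w \<Rightarrow> complex) set" where
  "D_Pz sV Y \<omega> sW act z = {\<alpha>. lin_functional sW \<alpha> \<and>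
     (\<forall>v. \<exists>N. \<forall>w. \<exists>p. conv_at_inf z (\<lambda>j. \<alpha> (Yo sV Y \<omega> sW act v j w)) (rat_fun z N p))}"

text \<open>Coefficient series (in x) of <Y^R_{P(z)}(v,x) alpha, w> = iota_{x;0} f_{v,alpha,w}:
  the Laurent series at 0 (valid in 0 < |x| < |z|) of the rational function f_{v,alpha,w}.\<close>
definition YR_ser ::
  "(complex \<Rightarrow> 'v::ab_group_add \<Rightarrow> 'v) \<Rightarrow> ('v \<Rightarrow> int \<Rightarrow> 'v \<Rightarrow> 'v) \<Rightarrow> 'v \<Rightarrow>
   (complex \<Rightarrow> 'w::ab_group_add \<Rightarrow> 'w) \<Rightarrow> ('v \<Rightarrow> int \<Rightarrow> 'w \<Rightarrow> 'w) \<Rightarrow> complex \<Rightarrow>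
   'v \<Rightarrow> ('w \<Rightarrow> complex) \<Rightarrow> 'w \<Rightarrow> int \<Rightarrow> complex" where
  "YR_ser sV Y \<omega> sW act z v \<alpha> w = (THE c. \<exists>N p.
     conv_at_inf z (\<lambda>j. \<alpha> (Yo sV Y \<omega> sW act v j w)) (rat_fun z N p) \<and>
     (\<forall>x. 0 < norm x \<and> norm x < norm z \<longrightarrow>
        ((\<lambda>n. c n * x powi n) has_sum rat_fun z N p x) UNIV))"

text \<open>Coefficient series of <Y^L_{P(z)}(v,x) alpha, w> = iota_{x;0}(f_{v,alpha,w}(x+z)).\<close>
definition YL_ser ::
  "(complex \<Rightarrow> 'v::ab_group_add \<Rightarrow> 'v) \<Rightarrow> ('v \<Rightarrow> int \<Rightarrow> 'v \<Rightarrow> 'v) \<Rightarrow> 'v \<Rightarrow>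
   (complex \<Rightarrow> 'w::ab_group_add \<Rightarrow> 'w) \<Rightarrow> ('v \<Rightarrow> int \<Rightarrow> 'w \<Rightarrow> 'w) \<Rightarrow> complex \<Rightarrow>
   'v \<Rightarrow> ('w \<Rightarrow> complex) \<Rightarrow> 'w \<Rightarrow> int \<Rightarrow> complex" where
  "YL_ser sV Y \<omega> sW act z v \<alpha> w = (THE c. \<exists>N p.
     conv_at_inf z (\<lambda>j. \<alpha> (Yo sV Y \<omega> sW act v j w)) (rat_fun z N p) \<and>
     (\<forall>x. 0 < norm x \<and> norm x < norm z \<longrightarrow>
        ((\<lambda>n. c n * x powi n) has_sum rat_fun z N p (x + z)) UNIV))"

text \<open>Coefficient of x^k in Y_{P(z)}(u (x) v, x) alpha = Y^L(u,x) Y^R(v,x) alpha, paired with w.\<close>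
definition YP_coef ::
  "(complex \<Rightarrow> 'v::ab_group_add \<Rightarrow> 'v) \<Rightarrow> ('v \<Rightarrow> int \<Rightarrow> 'v \<Rightarrow> 'v) \<Rightarrow> 'v \<Rightarrow>
   (complex \<Rightarrow> 'w::ab_group_add \<Rightarrow> 'w) \<Rightarrow> ('v \<Rightarrow> int \<Rightarrow> 'w \<Rightarrow> 'w) \<Rightarrow> complex \<Rightarrow>
   'v \<Rightarrow> 'v \<Rightarrow> ('w \<Rightarrow> complex) \<Rightarrow> int \<Rightarrow> 'w \<Rightarrow> complex" where
  "YP_coef sV Y \<omega> sW act z u v \<alpha> k w =
     (let t = (\<lambda>m w'. YL_ser sV Y \<omega> sW act z u
                        (\<lambda>w''. YR_ser sV Y \<omega> sW act z v \<alpha> w'' (k - m)) w' m)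
      in sum (\<lambda>m. t m w) {m. t m \<noteq> (\<lambda>_. 0)})"

text \<open>F is a V (x) V-homomorphism from W1 (x) W2 to (D_{P(z)}(W), Y_{P(z)}):
  F(Y(u (x) v, x)(w1 (x) w2)) = Y_{P(z)}(u (x) v, x) F(w1 (x) w2), coefficientwise.\<close>
definition VV_hom_to_D ::
  "(complex \<Rightarrow> 'v::ab_group_add \<Rightarrow> 'v) \<Rightarrow> ('v \<Rightarrow> int \<Rightarrow> 'v \<Rightarrow> 'v) \<Rightarrow> 'v \<Rightarrow>
   ('v \<Rightarrow> int \<Rightarrow> 'w1 \<Rightarrow> 'w1) \<Rightarrow> ('v \<Rightarrow> int \<Rightarrow> 'w2 \<Rightarrow> 'w2) \<Rightarrow>
   (complex \<Rightarrow> 'w::ab_group_add \<Rightarrow> 'w) \<Rightarrow> ('v \<Rightarrow> int \<Rightarrow> 'w \<Rightarrow> 'w) \<Rightarrow>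
   complex \<Rightarrow> ('w1 \<Rightarrow> 'w2 \<Rightarrow> 'w \<Rightarrow> complex) \<Rightarrow> bool" where
  "VV_hom_to_D sV Y \<omega> act1 act2 sW act z F \<longleftrightarrow>
    (\<forall>u v w1 w2 k w.
       (let t = (\<lambda>m. F (act1 u m w1) (act2 v (k - m) w2))
        in sum (\<lambda>m. t m w) {m. t m \<noteq> (\<lambda>_. 0)})
       = YP_coef sV Y \<omega> sW act z u v (F w1 w2) k w)"

end

theory Submission
  imports Defs "HOL-Complex_Analysis.Contour_Integration"
begin

text \<open>Paired with a fixed w, the three terms of the P(z)-Jacobi identity are built from three series:
  c, d, e, the coefficients of \<open>\<langle>F(w\<^sub>1 \<otimes> w\<^sub>2), Y\<^sup>o(v,x)w\<rangle>\<close>,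
  \<open>\<langle>F(w\<^sub>1 \<otimes> Y(v,x)w\<^sub>2), w\<rangle>\<close> and \<open>\<langle>F(Y(v,x)w\<^sub>1 \<otimes> w\<^sub>2), w\<rangle>\<close>.
  The identity holds if and only if c, d, e are the expansions at infinity, 0 and z of one rational
  function with poles at 0 and z only. For a monomial \<open>x^m (x-z)^n\<close> Vandermonde's convolution
  reduces the identity to \<open>m = n = 0\<close>, an identity between binomial coefficients. Conversely,
  lower truncation of d and e makes \<open>(x-z)^N c\<close> a Laurent polynomial for large N, which gives the rational
  function, and d and e are then determined by c, since a truncated series annihilated by an invertible
  one vanishes. The orders of d and e at their centres bound the pole orders, so N does not depend
  on w. In terms of \<open>Y\<^sub>P\<^sub>(\<^sub>z\<^sub>)\<close> the condition on d, e says
  \<open>Y\<^sup>R(v,x)F(w\<^sub>1 \<otimes> w\<^sub>2) = F(w\<^sub>1 \<otimes> Y(v,x)w\<^sub>2)\<close> and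
  \<open>Y\<^sup>L(v,x)F(w\<^sub>1 \<otimes> w\<^sub>2) = F(Y(v,x)w\<^sub>1 \<otimes> w\<^sub>2)\<close>, which is the homomorphism property because
  \<open>Y(v,x) \<otimes> 1\<close> and \<open>1 \<otimes> Y(v,x)\<close> come from \<open>v \<otimes> vac\<close> and \<open>vac \<otimes> v\<close>.\<close>

subsection \<open>Truncated series and the delta function identity\<close>

text \<open>The expansion of \<open>(s + y)^n\<close> in nonnegative powers of y.\<close>
definition binom_ser :: "int \<Rightarrow> complex \<Rightarrow> complex \<Rightarrow> nat \<Rightarrow> complex" where
  "binom_ser n s y i = (of_int n gchoose i) * y ^ i * s powi (n - int i)"

text \<open>The Laurent series x^m g(x).\<close>

definition ser_from :: "(nat \<Rightarrow> complex) \<Rightarrow> int \<Rightarrow> int \<Rightarrow> complex" where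
  "ser_from g m j = (if m \<le> j then g (nat (j - m)) else 0)"

text \<open>Product of a power series and a Laurent series; for \<open>d\<close> truncated from
  below only finitely many terms are nonzero, so \<open>fsum\<close> gives the true
  coefficient.\<close>

definition ser_conv :: "(nat \<Rightarrow> complex) \<Rightarrow> (int \<Rightarrow> complex) \<Rightarrow> int \<Rightarrow> complex" where
  "ser_conv g d k = fsum (\<lambda>i. g i * d (k - int i))"

lemma fsum_eq_sum:
  assumes "finite A" "\<And>i. i \<notin> A \<Longrightarrow> f i = 0"
  shows "fsum f = sum f A"
  unfolding fsum_def using assms by (intro sum.mono_neutral_left) auto

text \<open>The support inside \<open>fsum\<close> changes with the series; a range depending only
  on the bound \<open>m\<close> allows linearity in \<open>d\<close> to be proved termwise.\<close>

lemma ser_conv_eq_sum: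
  assumes "\<And>j. j < m \<Longrightarrow> d j = 0" "k - m < int K"
  shows "ser_conv g d k = (\<Sum>i<K. g i * d (k - int i))"
  unfolding ser_conv_def using assms by (intro fsum_eq_sum) auto

lemma lower_trunc_common_bound:
  assumes "lower_trunc d" "lower_trunc d'"
  obtains m where "\<And>j. j < m \<Longrightarrow> d j = 0" "\<And>j. j < m \<Longrightarrow> d' j = 0"
proof -
  obtain a b where "\<forall>n<a. d n = 0" "\<forall>n<b. d' n = 0"
    using assms by (auto simp: lower_trunc_def)
  then show ?thesis by (intro that[of "min a b"]) auto
qed

lemma ser_conv_diff:
  assumes "lower_trunc d" "lower_trunc d'"
  shows "ser_conv g (\<lambda>j. d j - d' j) k = ser_conv g d k - ser_conv g d' k"
proof -
  obtain m where m: "\<And>j. j < m \<Longrightarrow> d j = 0" "\<And>j. j < m \<Longrightarrow> d' j = 0"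
    by (rule lower_trunc_common_bound[OF assms]) blast
  have K: "k - m < int (nat (k - m) + 1)" by linarith
  have "ser_conv g (\<lambda>j. d j - d' j) k = (\<Sum>i<nat (k - m) + 1. g i * (d (k - int i) - d' (k - int i)))"
    by (rule ser_conv_eq_sum[OF _ K]) (simp only: m diff_self)
  then show ?thesis
    by (simp only: right_diff_distrib sum_subtractf
        ser_conv_eq_sum[of m d, OF m(1) K] ser_conv_eq_sum[of m d', OF m(2) K])
qed

lemma lower_trunc_uniform_bound:
  assumes "finite A" "\<And>l. l \<in> A \<Longrightarrow> lower_trunc (D l)"
  shows "\<exists>m. \<forall>l\<in>A. \<forall>j<m. D l j = 0"
  using assms
proof (induction A rule: finite_induct)
  case (insert x A)
  then obtain m where m: "\<forall>l\<in>A. \<forall>j<m. D l j = 0" by auto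
  obtain m' where m': "\<forall>j<m'. D x j = 0" using insert.prems[of x] by (auto simp: lower_trunc_def)
  show ?case using m m' by (intro exI[of _ "min m m'"]) auto
qed auto

lemma ser_conv_sum:
  assumes "finite A" "\<And>l. l \<in> A \<Longrightarrow> lower_trunc (D l)"
  shows "ser_conv g (\<lambda>j. \<Sum>l\<in>A. q l * D l j) k = (\<Sum>l\<in>A. q l * ser_conv g (D l) k)"
proof -
  obtain m where m: "\<And>l j. l \<in> A \<Longrightarrow> j < m \<Longrightarrow> D l j = 0"
    using lower_trunc_uniform_bound[of A D] assms by blast
  have K: "k - m < int (nat (k - m) + 1)" by linarith
  have "ser_conv g (\<lambda>j. \<Sum>l\<in>A. q l * D l j) k
      = (\<Sum>i<nat (k - m) + 1. g i * (\<Sum>l\<in>A. q l * D l (k - int i)))"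
    by (rule ser_conv_eq_sum[OF _ K]) (simp add: m)
  also have "\<dots> = (\<Sum>l\<in>A. q l * (\<Sum>i<nat (k - m) + 1. g i * D l (k - int i)))"
    unfolding sum_distrib_left by (subst sum.swap) (simp add: mult.left_commute)
  also have "\<dots> = (\<Sum>l\<in>A. q l * ser_conv g (D l) k)"
    by (intro sum.cong refl arg_cong2[where f = "(*)"] ser_conv_eq_sum[OF _ K, symmetric]) (simp add: m)
  finally show ?thesis .
qed

lemma lower_trunc_ser_from: "lower_trunc (ser_from g m)"
  unfolding lower_trunc_def ser_from_def by (intro exI[of _ m]) auto

text \<open>Leading-term argument: the lowest nonzero coefficient of \<open>d\<close>, multiplied by
  \<open>g 0\<close>, would survive in the product.\<close>

lemma ser_conv_eq_0_imp:
  assumes "lower_trunc d" "g 0 \<noteq> 0" "\<And>k. ser_conv g d k = 0"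
  shows "d j = 0"
proof -
  obtain m where m: "\<And>j. j < m \<Longrightarrow> d j = 0" using assms(1) by (auto simp: lower_trunc_def)
  have "d (m + int n) = 0" for n
  proof (induction n rule: less_induct)
    case (less n)
    have z: "d j = 0" if "j < m + int n" for j
      using that m[of j] less[of "nat (j - m)"] by (cases "j < m") auto
    have "ser_conv g d (m + int n) = (\<Sum>i<1. g i * d (m + int n - int i))"
      by (rule ser_conv_eq_sum[of "m + int n"]) (auto simp: z)
    then show ?case using assms(2,3) by simp
  qed
  from this[of "nat (j - m)"] m[of j] show ?thesis by (cases "j < m") auto
qed

text \<open>In a series variable x this multiplies (s + yx)^n by x^m (s + yx)^n', and Vandermonde's
  convolution adds the exponents.\<close>

lemma ser_conv_binom_ser:
  assumes "s \<noteq> 0"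
  shows "ser_conv (binom_ser n s y) (ser_from (binom_ser n' s y) m) k
       = ser_from (binom_ser (n + n') s y) m k"
proof (cases "m \<le> k")
  case True
  define r where "r = nat (k - m)"
  have k: "k = m + int r" using True by (simp add: r_def)
  have "ser_conv (binom_ser n s y) (ser_from (binom_ser n' s y) m) k
      = (\<Sum>i<Suc r. binom_ser n s y i * ser_from (binom_ser n' s y) m (k - int i))"
    by (rule ser_conv_eq_sum[of m]) (auto simp: ser_from_def k)
  also have "\<dots> = (\<Sum>i=0..r. ((of_int n gchoose i) * (of_int n' gchoose (r - i)))
                      * (y ^ r * s powi (n + n' - int r)))"
  proof (rule sum.cong)
    fix i assume i: "i \<in> {0..r}"
    have pow_s: "s powi (n - int i) * s powi (n' - int (r - i)) = s powi (n + n' - int r)"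
      using assms i by (subst power_int_add[symmetric]) (auto simp: of_nat_diff algebra_simps)
    have pow_y: "y ^ i * y ^ (r - i) = y ^ r" using i by (simp flip: power_add)
    have "nat (k - int i - m) = r - i" using k i by auto
    then have "binom_ser n s y i * ser_from (binom_ser n' s y) m (k - int i)
        = ((of_int n gchoose i) * (of_int n' gchoose (r - i)))
          * ((y ^ i * y ^ (r - i)) * (s powi (n - int i) * s powi (n' - int (r - i))))"
      using i k by (simp add: binom_ser_def ser_from_def mult_ac)
    then show "binom_ser n s y i * ser_from (binom_ser n' s y) m (k - int i)
        = ((of_int n gchoose i) * (of_int n' gchoose (r - i))) * (y ^ r * s powi (n + n' - int r))"
      by (simp only: pow_s pow_y)
  qed auto
  also have "\<dots> = binom_ser (n + n') s y r"
    by (simp only: sum_distrib_right[symmetric] gbinomial_Vandermonde)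
       (simp add: binom_ser_def)
  finally show ?thesis using True by (simp add: ser_from_def r_def)
next
  case False
  then show ?thesis
    using ser_conv_eq_sum[of m "ser_from (binom_ser n' s y) m" k 0]
    by (auto simp: ser_from_def)
qed

text \<open>The coefficient of \<open>x\<^sub>0^a x\<^sub>1^b\<close> in the P(z)-Jacobi identity. The series c is reversed so that
  all three series are truncated from below.\<close>
definition delta_identity ::
  "complex \<Rightarrow> (int \<Rightarrow> complex) \<Rightarrow> (int \<Rightarrow> complex) \<Rightarrow> (int \<Rightarrow> complex) \<Rightarrow> bool" where
  "delta_identity z c d e \<longleftrightarrow> (\<forall>a b.
     ser_conv (binom_ser (-a-1) 1 (-z)) (\<lambda>j. c (-j)) (-a-b-1)
     - ser_conv (binom_ser (-a-1) (-z) 1) d b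
     = ser_conv (binom_ser (-b-1) z 1) e a)"

lemma gbinomial_neg_of_nat:
  "(of_int (- int a - 1) gchoose b) = ((-1) ^ b * of_nat ((a + b) choose b) :: complex)"
proof -
  have "(of_int (- int a - 1) gchoose b) = ((- (1 + of_nat a)) gchoose b :: complex)"
    by (rule arg_cong[where f = "\<lambda>x. x gchoose b"]) simp
  also have "\<dots> = (-1) ^ b * (of_nat (a + b) gchoose b)"
    by (subst gbinomial_minus) (simp add: add.commute)
  finally show ?thesis by (simp only: binomial_gbinomial)
qed

lemma minus_powi: "(-z :: complex) powi n = (-1) powi n * z powi n"
  by (metis mult_minus1 power_int_mult_distrib)

lemma binom_ser_neg: "binom_ser (- int a - 1) s 1 r
    = (-1) ^ r * of_nat ((a + r) choose r) * s powi (- int a - 1 - int r)"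
  by (simp only: binom_ser_def gbinomial_neg_of_nat power_one mult_1_right)

lemma binom_ser_neg_1: "binom_ser (- int a - 1) 1 (-z) r = of_nat ((a + r) choose r) * z ^ r"
proof -
  have "binom_ser (- int a - 1) 1 (-z) r = of_nat ((a + r) choose r) * ((-1) ^ r * (-z) ^ r)"
    by (simp only: binom_ser_def gbinomial_neg_of_nat power_int_1_left mult_1_right mult_1_left mult_ac)
  also have "(-1) ^ r * (-z) ^ r = z ^ r" by (simp flip: power_mult_distrib)
  finally show ?thesis .
qed

lemma binom_ser_of_nat: "r \<le> n \<Longrightarrow> binom_ser (int n) s y r = of_nat (n choose r) * y ^ r * s ^ (n - r)"
  by (simp only: binom_ser_def of_int_of_nat_eq binomial_gbinomial of_nat_diff[symmetric] power_int_of_nat)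

lemma binom_ser_of_nat_eq_0: "n < r \<Longrightarrow> binom_ser (int n) s y r = 0"
  by (simp only: binom_ser_def of_int_of_nat_eq binomial_gbinomial[symmetric] binomial_eq_0
      of_nat_0 mult_zero_left)

lemma ser_from_0_simps: "ser_from g 0 (int r) = g r" "j < 0 \<Longrightarrow> ser_from g 0 j = 0"
  by (simp_all add: ser_from_def)

text \<open>The delta function identity itself, i.e. the case of the constant function 1.\<close>
lemma delta_identity_one:
  fixes z :: complex
  shows "ser_from (binom_ser (-a-1) 1 (-z)) 0 (-a-b-1) - ser_from (binom_ser (-a-1) (-z) 1) 0 b
       = ser_from (binom_ser (-b-1) z 1) 0 a"
proof -
  \<comment> \<open>The three series are supported on -a-b-1 >= 0, b >= 0 and a >= 0, so the signs
    of a and b decide which terms remain; each case is an identity between ordinary binomial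
    coefficients.\<close>
  consider (1) m n where "a = int m" "b = int n"
    | (2) m n where "a = int m" "b = - int n - 1"
    | (3) m n where "a = - int m - 1" "b = - int n - 1"
    | (4) m n where "a = - int m - 1" "b = int n"
  proof -
    have *: "\<exists>m. x = int m \<or> x = - int m - 1" for x
      by (rule exI[of _ "nat (if x \<ge> 0 then x else - x - 1)"]) auto
    show thesis using *[of a] *[of b] that by (elim exE disjE) blast+
  qed
  then show ?thesis
  proof cases
    case 1
    have q: "- int m - 1 - int n = - int n - 1 - int m" by simp
    have "(-z) powi (- int m - 1 - int n) = (-1) ^ (m + n + 1) * z powi (- int n - 1 - int m)"
      unfolding q by (subst minus_powi) (auto simp: power_int_minus_left uminus_power_if)
    moreover have "(m + n) choose n = (n + m) choose m"
      using binomial_symmetric[of n "m + n"] by (simp add: add.commute)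
    moreover have "(-1) ^ n * (-1) ^ (m + n + 1) = - ((-1) ^ m :: complex)"
      by (simp add: power_add)
    moreover have "- a - b - 1 < 0" using 1 by simp
    ultimately show ?thesis
      by (simp only: 1 ser_from_0_simps binom_ser_neg) (simp add: mult_ac)
  next
    case 2
    have neg: "b < 0" using 2 by simp
    have b: "- b - 1 = int n" using 2 by simp
    \<comment> \<open>The first series has index n - m. For m > n this is negative, and the
      right-hand side vanishes too, being a coefficient of degree m in an n-th power.\<close>
    show ?thesis
    proof (cases "m \<le> n")
      case True
      then have "- a - b - 1 = int (n - m)" using 2 by simp
      then show ?thesis using True binomial_symmetric[OF True]
        by (simp only: b ser_from_0_simps(2)[OF neg] 2(1) ser_from_0_simps(1) binom_ser_neg_1
            binom_ser_of_nat) simp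
    next
      case False
      then have "- a - b - 1 < 0" using 2 by simp
      with False show ?thesis
        by (simp only: b ser_from_0_simps(2)[OF neg] 2(1) ser_from_0_simps binom_ser_of_nat_eq_0
            not_le diff_0_right)
    qed
  next
    case 3
    have neg: "a < 0" "b < 0" and a: "- a - 1 = int m" using 3 by simp_all
    \<comment> \<open>Only the first series is left, and its index m + n + 1 exceeds the degree m of
      the polynomial (1 - zx)^m.\<close>
    have i: "- a - b - 1 = int (m + n + 1)" using 3 by simp
    show ?thesis
      by (simp only: i a ser_from_0_simps(2)[OF neg(1)] ser_from_0_simps(2)[OF neg(2)] ser_from_0_simps(1))
         (simp add: binom_ser_of_nat_eq_0)
  next
    case 4
    have neg: "a < 0" and a: "- a - 1 = int m" using 4 by simp_all
    show ?thesis
    proof (cases "n \<le> m")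
      case True
      then have "- a - b - 1 = int (m - n)" using 4 by simp
      then show ?thesis using True binomial_symmetric[OF True]
        by (simp only: a ser_from_0_simps(2)[OF neg] 4(2) ser_from_0_simps(1)
            binom_ser_of_nat diff_le_self) simp
    next
      case False
      then have "- a - b - 1 < 0" using 4 by simp
      with False show ?thesis
        by (simp only: a ser_from_0_simps(2)[OF neg] 4(2) ser_from_0_simps binom_ser_of_nat_eq_0
            not_le diff_self)
    qed
  qed
qed

text \<open>The expansions of \<open>rat_fun z N p\<close> at infinity, at 0, and at z (in powers of \<open>x - z\<close>).\<close>
definition laurent_inf :: "complex \<Rightarrow> complex poly \<Rightarrow> nat \<Rightarrow> int \<Rightarrow> complex" where
  "laurent_inf z p N j = (\<Sum>k\<le>degree p. coeff p k *
      ser_from (binom_ser (- int N) 1 (-z)) (2 * int N - int k) (-j))"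

definition laurent_zero :: "complex \<Rightarrow> complex poly \<Rightarrow> nat \<Rightarrow> int \<Rightarrow> complex" where
  "laurent_zero z p N j = (\<Sum>k\<le>degree p. coeff p k *
      ser_from (binom_ser (- int N) (-z) 1) (int k - int N) j)"

definition laurent_z :: "complex \<Rightarrow> complex poly \<Rightarrow> nat \<Rightarrow> int \<Rightarrow> complex" where
  "laurent_z z p N j = (\<Sum>k\<le>degree p. coeff p k *
      ser_from (binom_ser (int k - int N) z 1) (- int N) j)"

lemma ser_from_shift: "ser_from g m j = ser_from g 0 (j - m)"
  by (simp add: ser_from_def)

lemma lower_trunc_sum_ser_from:
  assumes "finite A"
  shows "lower_trunc (\<lambda>j. \<Sum>k\<in>A. q k * ser_from (g k) (m k) j)"
proof -
  obtain M where "\<forall>k\<in>A. \<forall>j<M. ser_from (g k) (m k) j = 0"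
    using lower_trunc_uniform_bound[of A "\<lambda>k. ser_from (g k) (m k)"] assms lower_trunc_ser_from by blast
  then show ?thesis unfolding lower_trunc_def by (intro exI[of _ M]) auto
qed

lemma lower_trunc_laurent:
  "lower_trunc (\<lambda>j. laurent_inf z p N (-j))" "lower_trunc (laurent_zero z p N)" "lower_trunc (laurent_z z p N)"
  unfolding laurent_inf_def laurent_zero_def laurent_z_def minus_minus
  by (rule lower_trunc_sum_ser_from[OF finite_atMost])+

text \<open>In each monomial x^(l - 2N) (1 - z/x)^(-N) the factor (1 - z/x)^n is absorbed. The case
  n = -a-1 serves the delta identity, the case n = N clears the pole at z.\<close>

lemma ser_conv_laurent_inf:
  "ser_conv (binom_ser n 1 (-z)) (\<lambda>j. laurent_inf z p N (-j)) k
   = (\<Sum>l\<le>degree p. coeff p l * ser_from (binom_ser (n - int N) 1 (-z)) (2 * int N - int l) k)"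
  unfolding laurent_inf_def minus_minus
  by (subst ser_conv_sum) (simp_all add: lower_trunc_ser_from ser_conv_binom_ser)

lemma delta_identity_laurent:
  assumes "z \<noteq> 0"
  shows "delta_identity z (laurent_inf z p N) (laurent_zero z p N) (laurent_z z p N)"
  unfolding delta_identity_def
proof (intro allI)
  fix a b :: int
  have 2: "ser_conv (binom_ser (-a-1) (-z) 1) (laurent_zero z p N) b
     = (\<Sum>l\<le>degree p. coeff p l * ser_from (binom_ser (-a-1 - int N) (-z) 1) (int l - int N) b)"
    unfolding laurent_zero_def using assms
    by (subst ser_conv_sum) (simp_all add: lower_trunc_ser_from ser_conv_binom_ser)
  have 3: "ser_conv (binom_ser (-b-1) z 1) (laurent_z z p N) a
     = (\<Sum>l\<le>degree p. coeff p l * ser_from (binom_ser (-b-1 + (int l - int N)) z 1) (- int N) a)"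
    unfolding laurent_z_def using assms
    by (subst ser_conv_sum) (simp_all add: lower_trunc_ser_from ser_conv_binom_ser)
  show "ser_conv (binom_ser (-a-1) 1 (-z)) (\<lambda>j. laurent_inf z p N (-j)) (-a-b-1)
     - ser_conv (binom_ser (-a-1) (-z) 1) (laurent_zero z p N) b
     = ser_conv (binom_ser (-b-1) z 1) (laurent_z z p N) a"
    unfolding ser_conv_laurent_inf 2 3 sum_subtractf[symmetric] right_diff_distrib[symmetric]
  proof (intro sum.cong refl arg_cong2[where f = "(*)"])
    fix l
    show "ser_from (binom_ser (-a-1 - int N) 1 (-z)) (2 * int N - int l) (-a-b-1)
        - ser_from (binom_ser (-a-1 - int N) (-z) 1) (int l - int N) b
        = ser_from (binom_ser (-b-1 + (int l - int N)) z 1) (- int N) a"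
      \<comment> \<open>The monomial x^(l - N) (x - z)^(-N) amounts to shifting a by N and b by N -
        l in the identity for the constant 1.\<close>
      using delta_identity_one[of "a + int N" z "b - int l + int N"]
      unfolding ser_from_shift[of _ "2 * int N - int l"] ser_from_shift[of _ "int l - int N"]
          ser_from_shift[of _ "- int N"]
      by (simp add: algebra_simps)
  qed
qed

section \<open>Uniqueness and rationality of solutions of the delta function identity\<close>

lemma binom_ser_0_neq_0: "s \<noteq> 0 \<Longrightarrow> binom_ser n s y 0 \<noteq> 0"
  by (simp add: binom_ser_def)

lemma ser_conv_below:
  assumes "\<And>j. j < m \<Longrightarrow> d j = 0" "k < m"
  shows "ser_conv g d k = 0"
  using ser_conv_eq_sum[of m d k 0 g] assms by simp

text \<open>Subtracting the two identities eliminates \<open>c\<close>. An index a below the support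
  of \<open>e - e'\<close> then isolates \<open>d - d'\<close>, multiplied by an invertible binomial
  series.\<close>

lemma delta_identity_unique:
  assumes z: "z \<noteq> 0"
    and de: "delta_identity z c d e" "delta_identity z c d' e'"
    and tr: "lower_trunc d" "lower_trunc d'" "lower_trunc e" "lower_trunc e'"
  shows "d = d'" "e = e'"
proof -
  obtain m where m: "\<And>j. j < m \<Longrightarrow> e j = 0" "\<And>j. j < m \<Longrightarrow> e' j = 0"
    using lower_trunc_common_bound[OF tr(3,4)] by metis
  have eq: "ser_conv (binom_ser (-b-1) z 1) (\<lambda>j. e j - e' j) a
      = - ser_conv (binom_ser (-a-1) (-z) 1) (\<lambda>j. d j - d' j) b" for a b
    using de unfolding delta_identity_def by (simp add: ser_conv_diff tr algebra_simps)
  have ltd: "lower_trunc (\<lambda>j. d j - d' j)" and lte: "lower_trunc (\<lambda>j. e j - e' j)"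
    using lower_trunc_common_bound[OF tr(1,2)] lower_trunc_common_bound[OF tr(3,4)]
    unfolding lower_trunc_def by (metis diff_0_right)+
  have "d j - d' j = 0" for j
  proof (rule ser_conv_eq_0_imp[OF ltd])
    \<comment> \<open>With \<open>a = m - 1\<close> the index a lies below all terms of \<open>e - e'\<close>.\<close>
    show "binom_ser (-(m-1)-1) (-z) 1 0 \<noteq> 0" using z by (simp add: binom_ser_0_neq_0)
    show "ser_conv (binom_ser (-(m-1)-1) (-z) 1) (\<lambda>j. d j - d' j) b = 0" for b
      using eq[of b "m - 1"] ser_conv_below[of m "\<lambda>j. e j - e' j" "m - 1"] m by simp
  qed
  then show "d = d'" by (simp add: fun_eq_iff)
  \<comment> \<open>Once d = d', any b serves; b = 0 leaves e - e' times the invertible series (z +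
    x)^(-1).\<close>
  then have 0: "ser_conv (binom_ser (-0-1) z 1) (\<lambda>j. e j - e' j) a = 0" for a
    using eq[of 0 a] by (simp add: ser_conv_def fsum_def)
  have "e j - e' j = 0" for j
    by (rule ser_conv_eq_0_imp[OF lte _ 0]) (use z in \<open>simp add: binom_ser_0_neq_0\<close>)
  then show "e = e'" by (simp add: fun_eq_iff)
qed

text \<open>The supports of \<open>d\<close> and \<open>e\<close> bound the pole orders at 0 and z,
  and truncation of the reversed \<open>c\<close> bounds the order at infinity, so x^N (x - z)^N
  c(x) is a polynomial.\<close>

lemma delta_identity_imp_laurent:
  assumes z: "z \<noteq> 0" and de: "delta_identity z c d e" and c: "lower_trunc (\<lambda>j. c (-j))"
    and d: "\<And>j. j < - int N \<Longrightarrow> d j = 0" and e: "\<And>j. j < - int N \<Longrightarrow> e j = 0"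
  shows "\<exists>p. c = laurent_inf z p N \<and> d = laurent_zero z p N \<and> e = laurent_z z p N"
proof -
  \<comment> \<open>\<open>G b\<close> is the coefficient of x^b in (x - z)^N c(x); the index N - b
    appears because the convolution runs in powers of 1/x.\<close>
  define G where "G b = ser_conv (binom_ser (int N) 1 (-z)) (\<lambda>j. c (-j)) (int N - b)" for b
  obtain m where m: "\<And>j. j < m \<Longrightarrow> c (-j) = 0" using c by (auto simp: lower_trunc_def)
  \<comment> \<open>The choice a = -N-1 makes the exponent -a-1 equal to N and lies below the
    support of \<open>e\<close>, while b lies below that of \<open>d\<close>.\<close>
  have G_low: "G b = 0" if "b < - int N" for b
    using de[unfolded delta_identity_def, rule_format, of "- int N - 1" b]
      ser_conv_below[of "- int N" d b] ser_conv_below[of "- int N" e "- int N - 1"] d e that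
    by (simp add: G_def)
  have G_high: "G b = 0" if "b > int N - m" for b
    unfolding G_def by (rule ser_conv_below[of m]) (use m that in auto)
  \<comment> \<open>\<open>G\<close> lives on -N, ..., N - m; multiplication by x^N moves this to 0,
    ..., 2N - m, that is, below \<open>K\<close>.\<close>
  define K where "K = nat (2 * int N - m + 1)"
  define p where "p = Poly (map (\<lambda>k. G (int k - int N)) [0..<K])"
  have p: "coeff p k = G (int k - int N)" for k
    using G_high[of "int k - int N"] by (auto simp: p_def nth_default_def K_def)
  \<comment> \<open>The exponent becomes N - N = 0, so each monomial contributes a single
    coefficient. Thus \<open>c\<close> and \<open>laurent_inf z p N\<close> have the same product
    with the invertible (1 - z/x)^N.\<close>
  have conv: "ser_conv (binom_ser (int N) 1 (-z)) (\<lambda>j. laurent_inf z p N (-j)) k = G (int N - k)" for k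
  proof -
    have "ser_conv (binom_ser (int N) 1 (-z)) (\<lambda>j. laurent_inf z p N (-j)) k
        = (\<Sum>l\<le>degree p. if int l = 2 * int N - k then coeff p l else 0)"
      unfolding ser_conv_laurent_inf
      by (intro sum.cong) (auto simp: ser_from_def binom_ser_def gbinomial_0_left)
    also have "\<dots> = G (int N - k)"
    proof (cases "2 * int N - k \<ge> 0")
      case True
      then obtain l where l: "2 * int N - k = int l" using nonneg_int_cases by metis
      have "(\<Sum>l'\<le>degree p. if int l' = 2 * int N - k then coeff p l' else 0) = coeff p l"
        unfolding l using coeff_eq_0[of p l] by (auto simp: sum.delta)
      moreover have "coeff p l = G (int N - k)"
        unfolding p by (rule arg_cong[where f = G]) (use l in simp)
      ultimately show ?thesis by (simp only:)
    next
      case False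
      then show ?thesis using G_low[of "int N - k"] by (intro trans[OF sum.neutral]) auto
    qed
    finally show ?thesis .
  qed
  have lt: "lower_trunc (\<lambda>j. c (-j) - laurent_inf z p N (-j))"
    using lower_trunc_common_bound[OF c lower_trunc_laurent(1)[of z p N]]
    unfolding lower_trunc_def by (metis diff_0_right)
  have "c (-j) - laurent_inf z p N (-j) = 0" for j
  proof (rule ser_conv_eq_0_imp[OF lt])
    show "binom_ser (int N) 1 (-z) 0 \<noteq> 0" by (simp add: binom_ser_0_neq_0)
    show "ser_conv (binom_ser (int N) 1 (-z)) (\<lambda>j. c (-j) - laurent_inf z p N (-j)) k = 0" for k
      using conv[of k] by (simp add: ser_conv_diff c lower_trunc_laurent G_def)
  qed
  from this[of "- j" for j] have ceq: "c = laurent_inf z p N" by (simp add: fun_eq_iff)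
  have "lower_trunc d" "lower_trunc e" using d e by (auto simp: lower_trunc_def)
  with delta_identity_unique[OF z de delta_identity_laurent[OF z, of p N, folded ceq]] lower_trunc_laurent ceq
  show ?thesis by blast
qed

subsection \<open>Convergence and uniqueness of Laurent expansions\<close>

text \<open>Scaling by s leaves the binomial series in t = y/s; absolute convergence for |t| < 1
  turns the ordered sum into an unordered one.\<close>

lemma has_sum_binom_ser:
  assumes "norm y < norm s"
  shows "(binom_ser n s y has_sum (s + y) powi n) UNIV"
proof -
  have s: "s \<noteq> 0" using assms by auto
  define t where "t = y / s"
  have t: "norm t < 1" using assms s by (simp add: t_def norm_divide)
  have "(\<lambda>i. (of_int n gchoose i) * t ^ i) sums (1 + t) powr of_int n"
    using gen_binomial_complex[OF t] .
  moreover have "1 + t \<noteq> 0" using t by (metis add.commute add_eq_0_iff less_irrefl norm_minus_cancel norm_one)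
  ultimately have "(\<lambda>i. (of_int n gchoose i) * t ^ i) sums (1 + t) powi n"
    by (simp add: complex_powr_of_int)
  moreover have "summable (\<lambda>i. norm ((of_int n gchoose i) * t ^ i))"
    by (rule abs_summable_in_conv_radius) (use t in \<open>simp add: conv_radius_gchoose\<close>)
  ultimately have "((\<lambda>i. (of_int n gchoose i) * t ^ i) has_sum (1 + t) powi n) UNIV"
    by (intro norm_summable_imp_has_sum)
  then have "((\<lambda>i. (of_int n gchoose i) * t ^ i * s powi n) has_sum (1 + t) powi n * s powi n) UNIV"
    by (rule has_sum_cmult_left)
  moreover have "(1 + t) powi n * s powi n = (s + y) powi n"
    using s by (simp add: t_def distrib_right flip: power_int_mult_distrib)
  moreover have "(of_int n gchoose i) * t ^ i * s powi n = binom_ser n s y i" for i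
    using s by (simp add: binom_ser_def t_def power_int_diff power_divide)
  ultimately show ?thesis by simp
qed

lemma binom_ser_mult_power: "binom_ser n s y i * x ^ i = binom_ser n s (y * x) i"
  by (simp add: binom_ser_def power_mult_distrib mult_ac)

lemma has_sum_ser_from:
  assumes "x \<noteq> 0" "((\<lambda>i. g i * x ^ i) has_sum S) UNIV"
  shows "((\<lambda>j. ser_from g m j * x powi j) has_sum x powi m * S) UNIV"
proof -
  have "((\<lambda>i. x powi m * (g i * x ^ i)) has_sum x powi m * S) UNIV"
    using assms(2) by (rule has_sum_cmult_right)
  also have "(\<lambda>i. x powi m * (g i * x ^ i)) = (\<lambda>i. ser_from g m (m + int i) * x powi (m + int i))"
    using assms(1) by (simp add: ser_from_def power_int_add fun_eq_iff mult_ac)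
  finally have sum: "((\<lambda>i. ser_from g m (m + int i) * x powi (m + int i)) has_sum x powi m * S) UNIV" .
  have "bij_betw (\<lambda>i. m + int i) UNIV {m..}"
    by (rule bij_betwI[where g = "\<lambda>j. nat (j - m)"]) auto
  from has_sum_reindex_bij_betw[OF this, THEN iffD1, OF sum]
  have "((\<lambda>j. ser_from g m j * x powi j) has_sum x powi m * S) {m..}" .
  then show ?thesis
    by (rule has_sum_cong_neutral[THEN iffD1, rotated -1]) (auto simp: ser_from_def)
qed

lemma has_sum_finite_sum:
  fixes f :: "'b \<Rightarrow> 'a \<Rightarrow> complex"
  assumes "finite A" "\<And>k. k \<in> A \<Longrightarrow> (f k has_sum S k) B"
  shows "((\<lambda>j. \<Sum>k\<in>A. f k j) has_sum (\<Sum>k\<in>A. S k)) B"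
  using assms by (induction A rule: finite_induct) (auto intro!: has_sum_add)

text \<open>Splits the function into the monomials on which the three expansions are
  defined.\<close>

lemma rat_fun_altdef:
  assumes "x \<noteq> 0" "x \<noteq> z"
  shows "rat_fun z N p x
    = (\<Sum>k\<le>degree p. coeff p k * (x powi (int k - int N) * (x - z) powi (- int N)))"
proof -
  have "x powi (int k - int N) * (x - z) powi (- int N) = x ^ k / (x ^ N * (x - z) ^ N)" for k
    using assms by (simp add: power_int_diff power_int_minus field_simps)
  then show ?thesis
    by (simp add: rat_fun_def poly_altdef sum_divide_distrib)
qed

lemma has_sum_laurent_zero:
  assumes "0 < norm x" "norm x < norm z"
  shows "((\<lambda>j. laurent_zero z p N j * x powi j) has_sum rat_fun z N p x) UNIV"
proof -
  have x: "x \<noteq> 0" "x \<noteq> z" using assms by auto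
  have "((\<lambda>i. binom_ser (- int N) (-z) 1 i * x ^ i) has_sum (x - z) powi (- int N)) UNIV"
    using has_sum_binom_ser[of x "-z" "- int N"] assms(2) by (simp add: binom_ser_mult_power)
  then have "((\<lambda>j. coeff p k * (ser_from (binom_ser (- int N) (-z) 1) (int k - int N) j * x powi j))
       has_sum coeff p k * (x powi (int k - int N) * (x - z) powi (- int N))) UNIV" for k
    by (intro has_sum_cmult_right has_sum_ser_from x)
  then show ?thesis unfolding rat_fun_altdef[OF x] laurent_zero_def sum_distrib_right mult.assoc
    by (intro has_sum_finite_sum) auto
qed

lemma has_sum_laurent_z:
  assumes "0 < norm x" "norm x < norm z"
  shows "((\<lambda>j. laurent_z z p N j * x powi j) has_sum rat_fun z N p (x + z)) UNIV"
proof -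
  have x: "x \<noteq> 0" "x + z \<noteq> 0" "x + z \<noteq> z"
    using assms by (auto simp: add_eq_0_iff2)
  have "((\<lambda>i. binom_ser n z 1 i * x ^ i) has_sum (x + z) powi n) UNIV" for n
    using has_sum_binom_ser[of x z n] assms(2) by (simp add: binom_ser_mult_power add.commute)
  then have "((\<lambda>j. coeff p k * (ser_from (binom_ser (int k - int N) z 1) (- int N) j * x powi j))
       has_sum coeff p k * (x powi (- int N) * (x + z) powi (int k - int N))) UNIV" for k
    by (intro has_sum_cmult_right has_sum_ser_from x)
  then have "((\<lambda>j. coeff p k * (ser_from (binom_ser (int k - int N) z 1) (- int N) j * x powi j))
       has_sum coeff p k * ((x + z) powi (int k - int N) * (x + z - z) powi (- int N))) UNIV" for k
    by (simp add: mult.commute)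
  then show ?thesis unfolding rat_fun_altdef[OF x(2,3)] laurent_z_def sum_distrib_right mult.assoc
    by (intro has_sum_finite_sum) auto
qed

lemma has_sum_laurent_inf:
  assumes "norm x > norm z"
  shows "((\<lambda>j. laurent_inf z p N j * x powi j) has_sum rat_fun z N p x) UNIV"
proof -
  have x: "x \<noteq> 0" "x \<noteq> z" using assms by auto
  have "norm (-z / x) < norm (1::complex)" using assms x by (simp add: norm_divide)
  from has_sum_binom_ser[OF this, of "- int N"]
  have "((\<lambda>i. binom_ser (- int N) 1 (-z) i * inverse x ^ i) has_sum (1 - z / x) powi (- int N)) UNIV"
    by (simp add: binom_ser_mult_power divide_inverse)
  then have "((\<lambda>j. coeff p k * (ser_from (binom_ser (- int N) 1 (-z)) (2 * int N - int k) j * inverse x powi j))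
       has_sum coeff p k * (inverse x powi (2 * int N - int k) * (1 - z / x) powi (- int N))) UNIV" for k
    using x by (intro has_sum_cmult_right has_sum_ser_from) auto
  \<comment> \<open>Returns from 1/x to x: x - z = x (1 - z/x), so (1 - z/x)^(-N) accounts for N of
    the 2N powers of 1/x.\<close>
  moreover have "inverse x powi (2 * int N - int k) * (1 - z / x) powi (- int N)
     = x powi (int k - int N) * (x - z) powi (- int N)" for k
  proof -
    have "1 - z / x = (x - z) * inverse x" using x by (simp add: field_simps)
    then have "inverse x powi (2 * int N - int k) * (1 - z / x) powi (- int N)
        = (x - z) powi (- int N) * (inverse x powi (2 * int N - int k) * inverse x powi (- int N))"
      by (simp add: power_int_mult_distrib mult_ac)
    also have "inverse x powi (2 * int N - int k) * inverse x powi (- int N) = inverse x powi (int N - int k)"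
      using x by (subst power_int_add[symmetric]) auto
    also have "\<dots> = x powi (int k - int N)"
      by (metis minus_diff_eq power_int_inverse power_int_minus)
    finally show ?thesis by (simp add: mult.commute)
  qed
  ultimately have "((\<lambda>j. coeff p k * (ser_from (binom_ser (- int N) 1 (-z)) (2 * int N - int k) j * inverse x powi j))
       has_sum coeff p k * (x powi (int k - int N) * (x - z) powi (- int N))) UNIV" for k
    by simp
  then have "((\<lambda>j. laurent_inf z p N (-j) * inverse x powi j) has_sum rat_fun z N p x) UNIV"
    unfolding rat_fun_altdef[OF x] laurent_inf_def minus_minus sum_distrib_right mult.assoc
    by (intro has_sum_finite_sum) auto
  also have "(\<lambda>j. laurent_inf z p N (-j) * inverse x powi j) = (\<lambda>j. laurent_inf z p N (-j) * x powi (-j))"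
    by (simp add: power_int_inverse power_int_minus)
  finally show ?thesis
    by (rule has_sum_reindex_bij_betw[THEN iffD1, rotated])
      (rule bij_betwI[where g = uminus], auto)
qed

text \<open>For complex families unordered summability coincides with absolute summability.\<close>

lemma conv_at_inf_iff:
  "conv_at_inf z c f \<longleftrightarrow> (\<forall>x. norm x > norm z \<longrightarrow> ((\<lambda>n. c n * x powi n) has_sum f x) UNIV)"
proof -
  have "(\<lambda>n. norm (c n * x powi n)) summable_on UNIV" if "((\<lambda>n. c n * x powi n) has_sum f x) UNIV" for x
    using has_sum_imp_summable[OF that] by (simp add: summable_on_iff_abs_summable_on_complex)
  then show ?thesis unfolding conv_at_inf_def by blast
qed

lemma conv_at_inf_laurent_inf: "conv_at_inf z (laurent_inf z p N) (rat_fun z N p)"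
  by (simp add: conv_at_inf_iff has_sum_laurent_inf)

section \<open>Uniqueness of Laurent coefficients by contour integration\<close>

lemma has_contour_integral_circlepath_powi:
  assumes "r > 0"
  shows "((\<lambda>x. x powi n) has_contour_integral (if n = -1 then 2 * of_real pi * \<i> else 0)) (circlepath 0 r)"
proof (cases "n = -1")
  case True
  have "((\<lambda>w. 1 / (w - 0)) has_contour_integral (2 * of_real pi * \<i>)) (circlepath 0 r)"
  proof -
    have "(\<lambda>w. 1 / (w - 0)) contour_integrable_on circlepath 0 r"
      by (rule contour_integrable_continuous_circlepath) (use assms in \<open>auto intro!: continuous_intros\<close>)
    then show ?thesis
      using has_contour_integral_integral contour_integral_circlepath[OF assms, of 0] by metis
  qed
  then show ?thesis using True by (simp add: power_int_minus field_simps)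
next
  case False
  have "((\<lambda>x. x powi n) has_contour_integral 0) (circlepath 0 r)"
  proof (rule Cauchy_theorem_primitive[where S = "-{0}" and f = "\<lambda>x. x powi (n + 1) / of_int (n + 1)"])
    fix x :: complex assume "x \<in> -{0}"
    moreover have "of_int (n + 1) \<noteq> (0 :: complex)" using False by (metis add_eq_0_iff2 of_int_eq_0_iff)
    ultimately show "((\<lambda>x. x powi (n + 1) / of_int (n + 1)) has_field_derivative x powi n) (at x within -{0})"
      by (auto intro!: derivative_eq_intros)
  qed (use assms in auto)
  then show ?thesis using False by simp
qed

text \<open>One circle suffices: the difference of the series is multiplied by x^(-k-1) and
  integrated termwise, and only the k-th term has a residue.\<close>

lemma laurent_coeffs_unique:
  fixes c c' :: "int \<Rightarrow> complex"
  assumes r: "r > 0"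
    and c: "\<And>x. norm x = r \<Longrightarrow> ((\<lambda>n. c n * x powi n) has_sum f x) UNIV"
    and c': "\<And>x. norm x = r \<Longrightarrow> ((\<lambda>n. c' n * x powi n) has_sum f x) UNIV"
  shows "c = c'"
proof
  fix k
  define d where "d n = c n - c' n" for n
  have d: "((\<lambda>n. d n * x powi n) has_sum 0) UNIV" if "norm x = r" for x
    using has_sum_add[OF c[OF that] has_sum_uminusI[OF c'[OF that]]] by (simp add: d_def algebra_simps)
  let ?g = "\<lambda>n x. d n * x powi (n - k - 1)"
  \<comment> \<open>M-test: the majorant is the norm of the terms at the point x = r, where
    convergence is absolute.\<close>
  have ul: "uniform_limit (sphere 0 r) (\<lambda>X x. \<Sum>n\<in>X. ?g n x) (\<lambda>_. 0) (finite_subsets_at_top UNIV)"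
  proof (rule Weierstrass_m_test_general')
    show "((\<lambda>n. ?g n x) has_sum 0) UNIV" if "x \<in> sphere 0 r" for x
    proof -
      have "x \<noteq> 0" using that r by auto
      then have "x powi (n - k - 1) = x powi n * x powi (- k - 1)" for n
        by (subst power_int_add[symmetric]) (auto simp: algebra_simps)
      then show ?thesis
        using has_sum_cmult_left[OF d[of x], of "x powi (- k - 1)"] that by (simp add: mult.assoc)
    qed
    have "(\<lambda>n. norm (d n * complex_of_real r powi n)) summable_on UNIV"
      using d[of "of_real r"] r summable_on_iff_abs_summable_on_complex has_sum_imp_summable by fastforce
    then have "(\<lambda>n. norm (d n * complex_of_real r powi n) * r powi (-k - 1)) summable_on UNIV"
      by (rule summable_on_cmult_left)
    moreover have "norm (d n * complex_of_real r powi n) * r powi (-k - 1) = norm (d n) * r powi (n - k - 1)" for n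
      using r power_int_add[of r n "-k - 1"] by (simp add: norm_mult norm_power_int add_diff_eq)
    ultimately show "(\<lambda>n. norm (d n) * r powi (n - k - 1)) summable_on UNIV"
      by simp
    show "norm (?g n x) \<le> norm (d n) * r powi (n - k - 1)" if "x \<in> sphere 0 r" for n x
      using that by (simp add: norm_mult norm_power_int)
  qed
  have ci: "((\<lambda>x. \<Sum>n\<in>X. ?g n x) has_contour_integral
        (\<Sum>n\<in>X. d n * (if n = k then 2 * of_real pi * \<i> else 0))) (circlepath 0 r)" if "finite X" for X
  proof (rule has_contour_integral_sum[OF that])
    show "(?g n has_contour_integral d n * (if n = k then 2 * of_real pi * \<i> else 0)) (circlepath 0 r)" for n
      using has_contour_integral_lmul[OF has_contour_integral_circlepath_powi[OF r, of "n - k - 1"], of "d n"]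
      by (simp split: if_splits)
  qed
  have "((\<lambda>X. contour_integral (circlepath 0 r) (\<lambda>x. \<Sum>n\<in>X. ?g n x)) \<longlongrightarrow>
      contour_integral (circlepath 0 r) (\<lambda>_. 0)) (finite_subsets_at_top UNIV)"
  proof (rule contour_integral_uniform_limit_circlepath(2)[OF _ ul _ r])
    show "\<forall>\<^sub>F X in finite_subsets_at_top UNIV. (\<lambda>x. \<Sum>n\<in>X. ?g n x) contour_integrable_on circlepath 0 r"
      by (rule eventually_finite_subsets_at_top_weakI) (rule has_contour_integral_integrable[OF ci])
  qed auto
  \<comment> \<open>As soon as X contains k the integral is the constant 2 pi i (d k), which must
    therefore equal the limit 0.\<close>
  moreover have "\<forall>\<^sub>F X in finite_subsets_at_top UNIV.
      contour_integral (circlepath 0 r) (\<lambda>x. \<Sum>n\<in>X. ?g n x) = d k * (2 * of_real pi * \<i>)"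
    unfolding eventually_finite_subsets_at_top
  proof (intro exI[of _ "{k}"] conjI allI impI)
    fix X assume X: "finite X \<and> {k} \<subseteq> X \<and> X \<subseteq> UNIV"
    show "contour_integral (circlepath 0 r) (\<lambda>x. \<Sum>n\<in>X. ?g n x) = d k * (2 * of_real pi * \<i>)"
      using contour_integral_unique[OF ci[of X]] X by (simp add: if_distrib cong: if_cong)
  qed auto
  ultimately have "((\<lambda>_. d k * (2 * of_real pi * \<i>)) \<longlongrightarrow> contour_integral (circlepath 0 r) (\<lambda>_. 0))
      (finite_subsets_at_top (UNIV :: int set))"
    by (rule Lim_transform_eventually)
  then have "d k * (2 * of_real pi * \<i>) = 0"
    by (simp add: tendsto_const_iff)
  then show "c k = c' k" by (simp add: d_def)
qed

section \<open>Well-definedness of the rational function and of its expansions\<close>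

lemma conv_at_inf_unique:
  assumes "conv_at_inf z c f" "conv_at_inf z c' f"
  shows "c = c'"
  by (rule laurent_coeffs_unique[where r = "norm z + 1" and f = f])
     (use assms in \<open>auto simp: conv_at_inf_iff add_nonneg_pos\<close>)

text \<open>After cross-multiplication two polynomials agree on the infinite set |x| > |z|, hence
  everywhere; off the poles one may divide back.\<close>

lemma rat_fun_eqI:
  fixes x z :: complex
  assumes "\<And>x. norm x > norm z \<Longrightarrow> rat_fun z N p x = rat_fun z M q x" "x \<noteq> 0" "x \<noteq> z"
  shows "rat_fun z N p x = rat_fun z M q x"
proof -
  let ?p = "p * ([:0, 1:] ^ M * [:-z, 1:] ^ M)" and ?q = "q * ([:0, 1:] ^ N * [:-z, 1:] ^ N)"
  have "poly ?p y = poly ?q y" if "norm y > norm z" for y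
  proof -
    have "y \<noteq> 0" "y \<noteq> z" using that by auto
    then show ?thesis using assms(1)[OF that] by (simp add: rat_fun_def frac_eq_eq)
  qed
  then have "{y. norm y > norm z} \<subseteq> {y. poly (?p - ?q) y = 0}" by auto
  moreover have "infinite {y :: complex. norm y > norm z}"
  proof
    assume "finite {y :: complex. norm y > norm z}"
    \<comment> \<open>Large natural numbers already supply infinitely many points of the exterior
      region.\<close>
    then have "finite ((\<lambda>n. of_nat (nat \<lceil>norm z\<rceil> + Suc n) :: complex) ` UNIV)"
      by (rule finite_subset[rotated]) (auto simp del: of_nat_Suc of_nat_add simp: norm_of_nat, linarith)
    then show False by (subst (asm) finite_image_iff) (auto simp: inj_on_def)
  qed
  ultimately have "?p - ?q = 0" using poly_roots_finite finite_subset by blast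
  then have "poly ?p x = poly ?q x" by simp
  then show ?thesis using assms(2,3) by (simp add: rat_fun_def frac_eq_eq)
qed

lemma conv_at_inf_rat_fun_unique:
  assumes "conv_at_inf z c (rat_fun z N p)" "conv_at_inf z c (rat_fun z M q)" "x \<noteq> 0" "x \<noteq> z"
  shows "rat_fun z N p x = rat_fun z M q x"
  by (rule rat_fun_eqI) (use assms in \<open>auto simp: conv_at_inf_iff intro: has_sum_unique\<close>)

text \<open>Evaluates the definite description: any other representation by \<open>M\<close> and
  \<open>q\<close> gives the same function off the poles, and its values on |x| = |z|/2 fix the
  coefficients.\<close>

lemma YR_ser_eqI:
  assumes z: "z \<noteq> 0" and conv: "conv_at_inf z (\<lambda>j. \<alpha> (Yo sV Y \<omega> sW act v j w)) (rat_fun z N p)"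
  shows "YR_ser sV Y \<omega> sW act z v \<alpha> w = laurent_zero z p N"
  unfolding YR_ser_def
proof (rule the_equality)
  fix c
  assume "\<exists>M q. conv_at_inf z (\<lambda>j. \<alpha> (Yo sV Y \<omega> sW act v j w)) (rat_fun z M q) \<and>
     (\<forall>x. 0 < norm x \<and> norm x < norm z \<longrightarrow> ((\<lambda>n. c n * x powi n) has_sum rat_fun z M q x) UNIV)"
  then obtain M q where q: "conv_at_inf z (\<lambda>j. \<alpha> (Yo sV Y \<omega> sW act v j w)) (rat_fun z M q)"
    "\<And>x::complex. 0 < norm x \<Longrightarrow> norm x < norm z \<Longrightarrow> ((\<lambda>n. c n * x powi n) has_sum rat_fun z M q x) UNIV"
    by blast
  show "c = laurent_zero z p N"
  proof (rule laurent_coeffs_unique)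
    show r: "norm z / 2 > 0" using z by simp
    fix x :: complex assume x: "norm x = norm z / 2"
    then have x': "0 < norm x" "norm x < norm z" using r z by (auto simp del: zero_less_norm_iff)
    show "((\<lambda>n. c n * x powi n) has_sum rat_fun z N p x) UNIV"
      using q(2)[OF x'] conv_at_inf_rat_fun_unique[OF conv q(1), of x] x' by fastforce
    show "((\<lambda>n. laurent_zero z p N n * x powi n) has_sum rat_fun z N p x) UNIV"
      by (rule has_sum_laurent_zero[OF x'])
  qed
qed (use conv has_sum_laurent_zero in blast)

lemma YL_ser_eqI:
  assumes z: "z \<noteq> 0" and conv: "conv_at_inf z (\<lambda>j. \<alpha> (Yo sV Y \<omega> sW act v j w)) (rat_fun z N p)"
  shows "YL_ser sV Y \<omega> sW act z v \<alpha> w = laurent_z z p N"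
  unfolding YL_ser_def
proof (rule the_equality)
  fix c
  assume "\<exists>M q. conv_at_inf z (\<lambda>j. \<alpha> (Yo sV Y \<omega> sW act v j w)) (rat_fun z M q) \<and>
     (\<forall>x. 0 < norm x \<and> norm x < norm z \<longrightarrow> ((\<lambda>n. c n * x powi n) has_sum rat_fun z M q (x + z)) UNIV)"
  then obtain M q where q: "conv_at_inf z (\<lambda>j. \<alpha> (Yo sV Y \<omega> sW act v j w)) (rat_fun z M q)"
    "\<And>x::complex. 0 < norm x \<Longrightarrow> norm x < norm z \<Longrightarrow> ((\<lambda>n. c n * x powi n) has_sum rat_fun z M q (x + z)) UNIV"
    by blast
  show "c = laurent_z z p N"
  proof (rule laurent_coeffs_unique)
    show r: "norm z / 2 > 0" using z by simp
    fix x :: complex assume x: "norm x = norm z / 2"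
    then have x': "0 < norm x" "norm x < norm z" using r z by (auto simp del: zero_less_norm_iff)
    \<comment> \<open>The condition 0 < |x| < |z| keeps x + z away from both poles.\<close>
    then have "x + z \<noteq> 0" "x + z \<noteq> z" by (auto simp: add_eq_0_iff2)
    then show "((\<lambda>n. c n * x powi n) has_sum rat_fun z N p (x + z)) UNIV"
      using q(2)[OF x'] conv_at_inf_rat_fun_unique[OF conv q(1), of "x + z"] by simp
    show "((\<lambda>n. laurent_z z p N n * x powi n) has_sum rat_fun z N p (x + z)) UNIV"
      by (rule has_sum_laurent_z[OF x'])
  qed
qed (use conv has_sum_laurent_z in blast)

subsection \<open>Weights and opposite vertex operators\<close>

lemma linear_rules:
  assumes "Vector_Spaces.linear s t f"
  shows "f 0 = 0" "f (x - y) = f x - f y" "f (s r x) = t r (f x)" "f (sum g S) = (\<Sum>i\<in>S. f (g i))"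
    "s r 0 = 0" "t r 0 = 0" "s 0 x = 0" "s 1 x = x" "s r x = 0 \<longleftrightarrow> r = 0 \<or> x = 0"
    "s q (s r x) = s (q * r) x" "s r (x - y) = s r x - s r y" "s (q - r) x = s q x - s r x"
    "s r (sum g S) = (\<Sum>i\<in>S. s r (g i))"
proof -
  interpret Vector_Spaces.linear s t f by (rule assms)
  show "f 0 = 0" "f (x - y) = f x - f y" "f (s r x) = t r (f x)" "f (sum g S) = (\<Sum>i\<in>S. f (g i))"
    by (rule zero diff scale sum)+
  show "s r 0 = 0" "t r 0 = 0" "s 0 x = 0" "s 1 x = x" "s r x = 0 \<longleftrightarrow> r = 0 \<or> x = 0"
    "s q (s r x) = s (q * r) x" "s r (x - y) = s r x - s r y" "s (q - r) x = s q x - s r x"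
    "s r (sum g S) = (\<Sum>i\<in>S. s r (g i))"
    by (simp_all add: vs1.scale_right_diff_distrib vs1.scale_left_diff_distrib vs1.scale_sum_right)
qed

lemma VOA_D:
  assumes "VOA sV Y vac \<omega>"
  shows "vector_space sV" "Vector_Spaces.linear sV sV (Y u n)"
    "n < 0 \<Longrightarrow> Y v n vac = 0" "vac \<in> wt_space sV Y \<omega> 0"
    "\<exists>S g. finite S \<and> (\<forall>n\<in>S. g n \<in> wt_space sV Y \<omega> n) \<and> v = sum g S"
    "\<exists>N. \<forall>n<N. wt_space sV Y \<omega> n = {0}"
    "\<exists>c::complex. \<forall>m n v.
        Lop Y \<omega> m (Lop Y \<omega> n v) - Lop Y \<omega> n (Lop Y \<omega> m v)
        = sV (of_int (m - n)) (Lop Y \<omega> (m + n) v)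
          + sV (if m + n = 0 then c * of_int (m^3 - m) / 12 else 0) v"
proof -
  note d = assms[unfolded VOA_def]
  show "vector_space sV"
    by (rule d[THEN conjunct1])
  note d = d[THEN conjunct2, THEN conjunct2]
  show "Vector_Spaces.linear sV sV (Y u n)"
    by (rule d[THEN conjunct1, THEN spec, THEN spec])
  note d = d[THEN conjunct2, THEN conjunct2, THEN conjunct2]
  show "n < 0 \<Longrightarrow> Y v n vac = 0"
    using d[THEN conjunct1, THEN spec, of v] by simp
  note d = d[THEN conjunct2, THEN conjunct2]
  show "\<exists>S g. finite S \<and> (\<forall>n\<in>S. g n \<in> wt_space sV Y \<omega> n) \<and> v = sum g S"
    using d[THEN conjunct1] by (rule spec)
  note d = d[THEN conjunct2, THEN conjunct2]
  show "\<exists>N. \<forall>n<N. wt_space sV Y \<omega> n = {0}"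
    by (rule d[THEN conjunct1])
  show "\<exists>c::complex. \<forall>m n v.
        Lop Y \<omega> m (Lop Y \<omega> n v) - Lop Y \<omega> n (Lop Y \<omega> m v)
        = sV (of_int (m - n)) (Lop Y \<omega> (m + n) v)
          + sV (if m + n = 0 then c * of_int (m^3 - m) / 12 else 0) v"
    by (rule d[THEN conjunct2, THEN conjunct1])
  show "vac \<in> wt_space sV Y \<omega> 0"
    by (rule d[THEN conjunct2, THEN conjunct2, THEN conjunct2, THEN conjunct2])
qed

lemma VOA_linear_Lop:
  assumes "VOA sV Y vac \<omega>"
  shows "Vector_Spaces.linear sV sV (Lop Y \<omega> n)"
  unfolding Lop_def by (rule VOA_D[OF assms])

lemma wt_space_independent:
  assumes "VOA sV Y vac \<omega>" and "finite S" "\<And>m. m \<in> S \<Longrightarrow> g m \<in> wt_space sV Y \<omega> m" "sum g S = 0"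
  shows "\<forall>m\<in>S. g m = 0"
proof -
  note L = linear_rules[OF VOA_linear_Lop[OF assms(1)]]
  show ?thesis using assms(2-)
  proof (induction S arbitrary: g rule: finite_induct)
    case (insert x S)
    \<comment> \<open>Applying L(0) - x multiplies \<open>g m\<close> by m - x: the component at x
      disappears and the others stay in their weight spaces with nonzero factors.\<close>
    define h where "h m = sV (of_int (m - x)) (g m)" for m
    have g: "Lop Y \<omega> 0 (g m) = sV (of_int m) (g m)" if "m \<in> insert x S" for m
      using insert.prems(1)[OF that] by (simp add: wt_space_def)
    have "h m \<in> wt_space sV Y \<omega> m" if "m \<in> S" for m
      using g[of m] that by (simp add: wt_space_def h_def L mult.commute)
    moreover have "sum h S = 0"
    proof -
      have "0 = Lop Y \<omega> 0 (sum g (insert x S)) - sV (of_int x) (sum g (insert x S))"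
        using insert.prems(2) by (simp add: L(1,5))
      also have "\<dots> = sum h (insert x S)"
        by (simp only: L(4,13) sum_subtractf[symmetric])
           (intro sum.cong refl, simp add: g h_def L(12))
      also have "\<dots> = sum h S" using insert.hyps by (simp add: h_def L(7))
      finally show ?thesis by simp
    qed
    ultimately have "\<forall>m\<in>S. h m = 0" by (intro insert.IH) auto
    then have 0: "\<forall>m\<in>S. g m = 0" using insert.hyps(2) by (auto simp: h_def L(9))
    then have "sum g S = 0" by simp
    then have "g x = 0" using insert.prems(2) insert.hyps by simp
    with 0 show ?case by simp
  qed simp
qed

lemma wt_space_closed:
  assumes "VOA sV Y vac \<omega>"
  shows "0 \<in> wt_space sV Y \<omega> n"
    "u \<in> wt_space sV Y \<omega> n \<Longrightarrow> v \<in> wt_space sV Y \<omega> n \<Longrightarrow> u - v \<in> wt_space sV Y \<omega> n"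
proof -
  note L = linear_rules[OF VOA_linear_Lop[OF assms(1)]]
  show "0 \<in> wt_space sV Y \<omega> n"
    "u \<in> wt_space sV Y \<omega> n \<Longrightarrow> v \<in> wt_space sV Y \<omega> n \<Longrightarrow> u - v \<in> wt_space sV Y \<omega> n"
    by (auto simp: wt_space_def L(1,2,5,11))
qed

text \<open>Independence of the weight spaces makes the decomposition of \<open>v\<close> unique, so
  the definite description selects its component.\<close>

lemma hcomp_eq:
  assumes V: "VOA sV Y vac \<omega>"
    and S: "finite S" "\<And>m. m \<in> S \<Longrightarrow> g m \<in> wt_space sV Y \<omega> m" "v = sum g S"
  shows "hcomp sV Y \<omega> n v = (if n \<in> S then g n else 0)"
  unfolding hcomp_def
proof (rule the_equality)
  have "v = (if n \<in> S then g n else 0) + sum g (S - {n})"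
    using S(1,3) sum.remove[of S n g] by auto
  then show "(if n \<in> S then g n else 0) \<in> wt_space sV Y \<omega> n \<and>
     (\<exists>S' g'. finite S' \<and> n \<notin> S' \<and> (\<forall>m\<in>S'. g' m \<in> wt_space sV Y \<omega> m)
        \<and> v = (if n \<in> S then g n else 0) + sum g' S')"
    using S(1,2) wt_space_closed(1)[OF V]
    by (intro conjI exI[of _ "S - {n}"] exI[of _ g]) simp_all
next
  fix u
  assume "u \<in> wt_space sV Y \<omega> n \<and>
     (\<exists>S' g'. finite S' \<and> n \<notin> S' \<and> (\<forall>m\<in>S'. g' m \<in> wt_space sV Y \<omega> m) \<and> v = u + sum g' S')"
  then obtain S' g' where u: "u \<in> wt_space sV Y \<omega> n" and S': "finite S'" "n \<notin> S'"
    "\<forall>m\<in>S'. g' m \<in> wt_space sV Y \<omega> m" "v = u + sum g' S'" by blast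
  \<comment> \<open>Both decompositions of \<open>v\<close> are extended by zero to a common index
    set, so that their difference is a vanishing sum of weight vectors.\<close>
  define h1 where "h1 m = (if m \<in> S then g m else 0)" for m
  define h2 where "h2 m = (if m = n then u else if m \<in> S' then g' m else 0)" for m
  let ?T = "insert n (S \<union> S')"
  have "sum h1 ?T = v" unfolding S(3) h1_def using S(1) S'(1)
    by (subst sum.mono_neutral_cong_right[of ?T S _ g]) auto
  moreover have "sum h2 ?T = v"
  proof -
    have "sum h2 ?T = sum h2 (insert n S')"
      using S(1) S'(1) by (intro sum.mono_neutral_right) (auto simp: h2_def)
    also have "\<dots> = u + sum h2 S'" using S'(1,2) by (simp add: h2_def)
    also have "sum h2 S' = sum g' S'" using S'(2) by (intro sum.cong) (auto simp: h2_def)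
    finally show ?thesis using S'(4) by simp
  qed
  ultimately have "(\<Sum>m\<in>?T. h1 m - h2 m) = 0" by (simp add: sum_subtractf)
  moreover have "h1 m - h2 m \<in> wt_space sV Y \<omega> m" for m
    using S(2) S'(3) u by (intro wt_space_closed[OF V]) (auto simp: h1_def h2_def wt_space_closed(1)[OF V])
  ultimately have "\<forall>m\<in>?T. h1 m - h2 m = 0"
    by (intro wt_space_independent[OF V]) (use S(1) S'(1) in auto)
  then have "h1 n = h2 n" by auto
  then show "u = (if n \<in> S then g n else 0)" by (simp add: h1_def h2_def)
qed

text \<open>The Virasoro relation gives [L(0), L(1)] = -L(1); the central term occurs only for m + n
  = 0.\<close>

lemma L1_wt_space:
  assumes V: "VOA sV Y vac \<omega>" and u: "u \<in> wt_space sV Y \<omega> n"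
  shows "Lop Y \<omega> 1 u \<in> wt_space sV Y \<omega> (n - 1)"
proof -
  note L = linear_rules[OF VOA_linear_Lop[OF V]]
  obtain c where c: "\<forall>m n v. Lop Y \<omega> m (Lop Y \<omega> n v) - Lop Y \<omega> n (Lop Y \<omega> m v)
        = sV (of_int (m - n)) (Lop Y \<omega> (m + n) v)
          + sV (if m + n = 0 then c * of_int (m^3 - m) / 12 else 0) v"
    using VOA_D(7)[OF V] by blast
  have "Lop Y \<omega> 0 (Lop Y \<omega> 1 u) = Lop Y \<omega> 1 (Lop Y \<omega> 0 u) - Lop Y \<omega> 1 u"
    using c[rule_format, of 0 1 u] L(12)[of 0 1 "Lop Y \<omega> 1 u"]
    by (simp add: L(7,8) diff_eq_eq)
  also have "\<dots> = sV (of_int (n - 1)) (Lop Y \<omega> 1 u)"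
    using u by (simp add: wt_space_def L(3,8,12))
  finally show ?thesis by (simp add: wt_space_def)
qed

text \<open>Makes the double sum in \<open>Yo\<close> finite: \<open>v\<close> has finitely many
  components, L(1) lowers weights, and weights are bounded below.\<close>

lemma finite_L1_hcomp:
  assumes V: "VOA sV Y vac \<omega>"
  shows "finite {(n, k). (Lop Y \<omega> 1 ^^ k) (hcomp sV Y \<omega> n v) \<noteq> 0}"
proof -
  obtain S g where S: "finite S" "\<forall>n\<in>S. g n \<in> wt_space sV Y \<omega> n" "v = sum g S"
    using VOA_D(5)[OF V, of v] by (elim exE conjE) (rule that)
  note h = hcomp_eq[OF V S(1) S(2)[rule_format] S(3)]
  obtain N where N: "\<forall>n<N. wt_space sV Y \<omega> n = {0}" using VOA_D(6)[OF V] by blast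
  have wt: "(Lop Y \<omega> 1 ^^ k) (hcomp sV Y \<omega> n v) \<in> wt_space sV Y \<omega> (n - int k)" for n k
  proof (induction k)
    case 0 then show ?case using S(2) by (simp add: h wt_space_closed(1)[OF V])
  next
    case (Suc k) then show ?case using L1_wt_space[OF V, of _ "n - int k"] by (simp add: algebra_simps)
  qed
  note L = linear_rules[OF VOA_linear_Lop[OF V]]
  have L0: "(Lop Y \<omega> 1 ^^ k) 0 = 0" for k by (induction k) (auto simp: L(1))
  have "(n, k) \<in> Sigma S (\<lambda>n. {..nat (n - N)})"
    if "(Lop Y \<omega> 1 ^^ k) (hcomp sV Y \<omega> n v) \<noteq> 0" for n k
  proof -
    have "n \<in> S" using that L0 by (auto simp: h split: if_splits)
    moreover have "\<not> n - int k < N" using N wt[of k n] that by auto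
    ultimately show ?thesis by auto
  qed
  then have "{(n, k). (Lop Y \<omega> 1 ^^ k) (hcomp sV Y \<omega> n v) \<noteq> 0} \<subseteq> Sigma S (\<lambda>n. {..nat (n - N)})"
    by blast
  then show ?thesis by (rule finite_subset) (use S(1) in auto)
qed

lemma weak_module_D:
  assumes "weak_module sV Y vac sW act"
  shows "sW r 0 = 0" "act 0 n w = 0" "act v n 0 = 0" "lower_trunc (\<lambda>n. act v n w)"
    "act vac n w = (if n = 0 then w else 0)" "sW 1 w = w"
proof -
  have l: "Vector_Spaces.linear sV sW (\<lambda>u. act u n w)" "Vector_Spaces.linear sW sW (act v n)"
    using assms by (auto simp: weak_module_def)
  show "act 0 n w = 0" "act v n 0 = 0" "sW r 0 = 0" "sW 1 w = w"
    using linear_rules(1)[OF l(1)] linear_rules(1,5,8)[OF l(2)] by simp_all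
  show "lower_trunc (\<lambda>n. act v n w)" "act vac n w = (if n = 0 then w else 0)"
    using assms by (auto simp: weak_module_def)
qed

lemma fsum_0: "(\<And>i. f i = 0) \<Longrightarrow> fsum f = 0"
  by (simp add: fsum_def)

lemma Yo_zero_right:
  assumes "weak_module sV Y vac sW act"
  shows "Yo sV Y \<omega> sW act v j 0 = 0"
proof -
  show ?thesis unfolding Yo_def by (intro fsum_0) (simp add: weak_module_D[OF assms])
qed

text \<open>Finitely many modes series occur in Y^o(v,x)w, each in the variable 1/x, so the powers
  of x are bounded above.\<close>

lemma lower_trunc_Yo:
  assumes V: "VOA sV Y vac \<omega>" and W: "weak_module sV Y vac sW act"
  shows "lower_trunc (\<lambda>j. Yo sV Y \<omega> sW act v (-j) w)"
proof -
  define x where "x n k = (Lop Y \<omega> 1 ^^ k) (hcomp sV Y \<omega> n v)" for n k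
  define P where "P = {(n, k). x n k \<noteq> 0}"
  have P: "finite P" using finite_L1_hcomp[OF V] by (simp add: P_def x_def)
  obtain M where M: "\<And>n k i. (n, k) \<in> P \<Longrightarrow> i < M \<Longrightarrow> act (x n k) i w = 0"
    using lower_trunc_uniform_bound[OF P, of "\<lambda>(n, k) i. act (x n k) i w"] weak_module_D(4)[OF W] by fastforce
  \<comment> \<open>\<open>B\<close> bounds the shift k - 2n over the finite set \<open>P\<close>,
    so j < M - B forces the index k - 2n + j below \<open>M\<close>.\<close>
  obtain B where B: "\<And>n k. (n, k) \<in> P \<Longrightarrow> int k - 2 * n \<le> B"
  proof
    show "int k - 2 * n \<le> Max ((\<lambda>(n, k). int k - 2 * n) ` P)" if "(n, k) \<in> P" for n k
      using P that by (intro Max_ge) force+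
  qed
  have "act (x n k) (int k - 2 * n - (- j)) w = 0" if "j < M - B" for n k j
    using M[of n k "int k - 2 * n - (-j)"] B[of n k] that weak_module_D(2)[OF W]
    by (cases "(n, k) \<in> P") (auto simp: P_def)
  then show ?thesis unfolding lower_trunc_def Yo_def
    by (intro exI[of _ "M - B"] allI impI fsum_0) (simp add: x_def weak_module_D(1)[OF W])
qed

text \<open>The vacuum has weight 0 and is annihilated by L(1), which leaves only the term n = k =
  0.\<close>

lemma Yo_vac:
  assumes V: "VOA sV Y vac \<omega>" and W: "weak_module sV Y vac sW act"
  shows "Yo sV Y \<omega> sW act vac j w = (if j = 0 then w else 0)"
proof -
  note L = linear_rules[OF VOA_linear_Lop[OF V]]
  have h: "hcomp sV Y \<omega> n vac = (if n = 0 then vac else 0)" for n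
    using hcomp_eq[OF V, of "{0}" "\<lambda>_. vac" vac n] VOA_D(4)[OF V] by simp
  have L0: "(Lop Y \<omega> 1 ^^ k) 0 = 0" for k by (induction k) (auto simp: L(1))
  have Lv: "(Lop Y \<omega> 1 ^^ k) vac = (if k = 0 then vac else 0)" for k
  proof (cases k)
    case (Suc m)
    have "Lop Y \<omega> 1 vac = 0" using VOA_D(3)[OF V] by (simp add: Lop_def)
    then show ?thesis using Suc L0 by (simp add: funpow_Suc_right del: funpow.simps)
  qed simp
  define t where "t n k = sW ((-1::complex) powi n / of_nat (fact k))
         (act ((Lop Y \<omega> 1 ^^ k) (hcomp sV Y \<omega> n vac)) (int k - 2 * n - j) w)" for n k
  have t0: "t n k = 0" if "n \<noteq> 0 \<or> k \<noteq> 0" for n k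
    using that by (auto simp: t_def h L0 Lv weak_module_D(1,2)[OF W])
  have "fsum (t n) = (if n = 0 then t 0 0 else 0)" for n
    using fsum_eq_sum[of "{0}" "t n"] by (auto simp: t0)
  then have "fsum (\<lambda>n. fsum (t n)) = t 0 0"
    using fsum_eq_sum[of "{0}" "\<lambda>n. fsum (t n)"] by simp
  moreover have "Yo sV Y \<omega> sW act vac j w = fsum (\<lambda>n. fsum (t n))"
    unfolding Yo_def t_def[abs_def] by (rule refl)
  moreover have "t 0 0 = (if j = 0 then w else 0)"
    by (simp add: t_def h weak_module_D(1,5,6)[OF W])
  ultimately show ?thesis by simp
qed

subsection \<open>Intertwining maps\<close>

lemma bilinear_to_dual_D:
  assumes "bilinear_to_dual s1 s2 sW F"
  shows "lin_functional sW (F w1 w2)" "F 0 w2 = (\<lambda>_. 0)" "F w1 0 = (\<lambda>_. 0)" "F w1 w2 0 = 0"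
proof -
  show "lin_functional sW (F w1 w2)" using assms by (simp add: bilinear_to_dual_def)
  then have "F w1 w2 (0 + 0) = F w1 w2 0 + F w1 w2 0" unfolding lin_functional_def by blast
  then show "F w1 w2 0 = 0" by simp
  have "F (0 + 0) w2 = (\<lambda>w. F 0 w2 w + F 0 w2 w)" "F w1 (0 + 0) = (\<lambda>w. F w1 0 w + F w1 0 w)"
    using assms unfolding bilinear_to_dual_def by blast+
  then show "F 0 w2 = (\<lambda>_. 0)" "F w1 0 = (\<lambda>_. 0)" by (simp_all add: fun_eq_iff)
qed

lemma fsum_cmult: "fsum (\<lambda>i. c * f i) = c * fsum f" for c :: complex
proof (cases "c = 0")
  case False
  then show ?thesis by (simp add: fsum_def sum_distrib_left)
qed (simp add: fsum_def)

text \<open>Only signs and binomials need matching: (-z)^(-a-1-i) contributes (-1)^(a+1+i), and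
  upper negation turns (-b-1 choose i) into (-1)^i (b+i choose i).\<close>

lemma P_intertwining_iff:
  "P_intertwining sV Y \<omega> s1 act1 s2 act2 sW act z F \<longleftrightarrow>
   (\<forall>v w1 w2 w. delta_identity z (\<lambda>j. F w1 w2 (Yo sV Y \<omega> sW act v j w))
      (\<lambda>n. F w1 (act2 v n w2) w) (\<lambda>n. F (act1 v n w1) w2 w))"
proof -
  have 1: "ser_conv (binom_ser (-a-1) 1 (-z)) (\<lambda>j. c (-j)) (-a-b-1)
      = fsum (\<lambda>i. (of_int (-a-1) gchoose i) * (-z)^i * c (b + a + 1 + int i))" for a b c
    unfolding ser_conv_def binom_ser_def
    by (intro arg_cong[where f = fsum] ext) (simp add: algebra_simps)
  have 2: "ser_conv (binom_ser (-a-1) (-z) 1) d b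
      = (-1) powi (a+1) * fsum (\<lambda>i. (of_int (-a-1) gchoose i) * z powi (-a-1-int i) * (-1)^i * d (b - int i))" for a b d
    unfolding ser_conv_def binom_ser_def fsum_cmult[symmetric]
  proof (intro arg_cong[where f = fsum] ext)
    fix i
    have "(-z) powi (-a-1-int i) = (-1) powi (a+1) * (-1)^i * z powi (-a-1-int i)"
      by (subst minus_powi) (auto simp: power_int_minus_left uminus_power_if)
    then show "(of_int (-a-1) gchoose i) * 1 ^ i * (-z) powi (-a-1-int i) * d (b - int i)
      = (-1) powi (a+1) * ((of_int (-a-1) gchoose i) * z powi (-a-1-int i) * (-1)^i * d (b - int i))"
      by (simp add: mult_ac)
  qed
  have 3: "ser_conv (binom_ser (-b-1) z 1) e a
      = fsum (\<lambda>i. z powi (-b-int i-1) * (of_int (b + int i) gchoose i) * (-1)^i * e (a - int i))" for a b e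
    unfolding ser_conv_def binom_ser_def
  proof (intro arg_cong[where f = fsum] ext)
    fix i
    have p: "z powi (-b-1-int i) = z powi (-b-int i-1)"
      by (rule arg_cong[where f = "power_int z"]) simp
    have q: "(of_int (-b-1) gchoose i) = (-1)^i * ((of_int (b + int i) :: complex) gchoose i)"
      by (subst gbinomial_negated_upper) (simp add: algebra_simps)
    show "(of_int (-b-1) gchoose i) * 1 ^ i * z powi (-b-1-int i) * e (a - int i)
      = z powi (-b-int i-1) * (of_int (b + int i) gchoose i) * (-1)^i * e (a - int i)"
      unfolding p q by (simp add: mult_ac)
  qed
  show ?thesis unfolding P_intertwining_def delta_identity_def 2 3
      1[where c = "\<lambda>j. F w1 w2 (Yo sV Y \<omega> sW act v j w)" for w1 w2 v w]
    by (rule refl)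
qed

lemma laurent_const:
  "laurent_inf z [:a:] 0 = (\<lambda>j. if j = 0 then a else 0)"
  "laurent_zero z [:a:] 0 = (\<lambda>j. if j = 0 then a else 0)"
  "laurent_z z [:a:] 0 = (\<lambda>j. if j = 0 then a else 0)"
  by (auto simp: laurent_inf_def laurent_zero_def laurent_z_def ser_from_def binom_ser_def gbinomial_0_left fun_eq_iff)

text \<open>A constant function has the same expansion at every point. This covers the vacuum, the
  zero functional and the zero vector.\<close>

lemma YRL_ser_delta:
  assumes "z \<noteq> 0" "\<And>j. \<alpha> (Yo sV Y \<omega> sW act v j w) = (if j = 0 then a else 0)"
  shows "YR_ser sV Y \<omega> sW act z v \<alpha> w = (\<lambda>j. if j = 0 then a else 0)"
    "YL_ser sV Y \<omega> sW act z v \<alpha> w = (\<lambda>j. if j = 0 then a else 0)"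
proof -
  have "conv_at_inf z (\<lambda>j. \<alpha> (Yo sV Y \<omega> sW act v j w)) (rat_fun z 0 [:a:])"
    using conv_at_inf_laurent_inf[of z "[:a:]" 0] by (simp add: assms(2) laurent_const)
  from YR_ser_eqI[OF assms(1) this] YL_ser_eqI[OF assms(1) this]
  show "YR_ser sV Y \<omega> sW act z v \<alpha> w = (\<lambda>j. if j = 0 then a else 0)"
    "YL_ser sV Y \<omega> sW act z v \<alpha> w = (\<lambda>j. if j = 0 then a else 0)"
    by (simp_all add: laurent_const)
qed

lemma sum_single_support:
  assumes "\<And>m. m \<noteq> k \<Longrightarrow> t m = (\<lambda>_. 0)"
  shows "(\<Sum>m\<in>{m. t m \<noteq> (\<lambda>_. 0)}. t m w) = t k w"
proof -
  \<comment> \<open>If \<open>t k\<close> vanishes as well, the index set is empty rather than the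
    singleton of k.\<close>
  have "t k w = 0" if "{m. t m \<noteq> (\<lambda>_. 0)} = {}" using that by auto
  moreover have "{m. t m \<noteq> (\<lambda>_. 0)} \<subseteq> {k}" using assms by auto
  ultimately show ?thesis by (auto simp: subset_singleton_iff)
qed

lemma P_intertwining_imp:
  assumes V: "VOA sV Y vac \<omega>"
    and W: "weak_module sV Y vac s1 act1" "weak_module sV Y vac s2 act2" "weak_module sV Y vac sW act"
    and z: "z \<noteq> 0" and F: "bilinear_to_dual s1 s2 sW F"
    and P: "P_intertwining sV Y \<omega> s1 act1 s2 act2 sW act z F"
  shows "F w1 w2 \<in> D_Pz sV Y \<omega> sW act z"
    and "YR_ser sV Y \<omega> sW act z v (F w1 w2) w = (\<lambda>n. F w1 (act2 v n w2) w)"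
    and "YL_ser sV Y \<omega> sW act z v (F w1 w2) w = (\<lambda>n. F (act1 v n w1) w2 w)"
proof -
  have ex: "\<exists>N. \<forall>w. \<exists>p. (\<lambda>j. F w1 w2 (Yo sV Y \<omega> sW act v j w)) = laurent_inf z p N
      \<and> (\<lambda>n. F w1 (act2 v n w2) w) = laurent_zero z p N \<and> (\<lambda>n. F (act1 v n w1) w2 w) = laurent_z z p N" for v
  proof -
    obtain M1 M2 where M: "\<And>n. n < M1 \<Longrightarrow> act1 v n w1 = 0" "\<And>n. n < M2 \<Longrightarrow> act2 v n w2 = 0"
      using weak_module_D(4)[OF W(1), of v w1] weak_module_D(4)[OF W(2), of v w2]
      unfolding lower_trunc_def by blast
    \<comment> \<open>\<open>N\<close> comes from the truncation of the actions on \<open>w1\<close>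
      and \<open>w2\<close> alone, so the pole bound is uniform in \<open>w\<close>, as
      \<open>D_Pz\<close> demands.\<close>
    define N where "N = nat (- min M1 M2)"
    show ?thesis
    proof (intro exI[of _ N] allI delta_identity_imp_laurent[OF z])
      fix w
      show "delta_identity z (\<lambda>j. F w1 w2 (Yo sV Y \<omega> sW act v j w))
          (\<lambda>n. F w1 (act2 v n w2) w) (\<lambda>n. F (act1 v n w1) w2 w)"
        using P unfolding P_intertwining_iff by blast
      show "lower_trunc (\<lambda>j. F w1 w2 (Yo sV Y \<omega> sW act v (- j) w))"
        using lower_trunc_Yo[OF V W(3), of v w] bilinear_to_dual_D(4)[OF F]
        unfolding lower_trunc_def by metis
      show "F w1 (act2 v j w2) w = 0" "F (act1 v j w1) w2 w = 0" if "j < - int N" for j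
      proof -
        have "j < M1" "j < M2" using that by (auto simp: N_def split: if_splits)
        then show "F w1 (act2 v j w2) w = 0" "F (act1 v j w1) w2 w = 0"
          by (simp_all add: M bilinear_to_dual_D[OF F])
      qed
    qed
  qed
  show "F w1 w2 \<in> D_Pz sV Y \<omega> sW act z"
    unfolding D_Pz_def mem_Collect_eq
  proof (intro conjI allI)
    show "lin_functional sW (F w1 w2)" by (rule bilinear_to_dual_D(1)[OF F])
    fix v
    obtain N where N: "\<And>w. \<exists>p. (\<lambda>j. F w1 w2 (Yo sV Y \<omega> sW act v j w)) = laurent_inf z p N"
      using ex[of v] by blast
    have "\<exists>p. conv_at_inf z (\<lambda>j. F w1 w2 (Yo sV Y \<omega> sW act v j w)) (rat_fun z N p)" for w
      using N[of w] conv_at_inf_laurent_inf[of z _ N] by (elim exE) (simp, blast)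
    then show "\<exists>N. \<forall>w. \<exists>p. conv_at_inf z (\<lambda>j. F w1 w2 (Yo sV Y \<omega> sW act v j w)) (rat_fun z N p)"
      by blast
  qed
  obtain N p where p: "(\<lambda>j. F w1 w2 (Yo sV Y \<omega> sW act v j w)) = laurent_inf z p N"
    "(\<lambda>n. F w1 (act2 v n w2) w) = laurent_zero z p N" "(\<lambda>n. F (act1 v n w1) w2 w) = laurent_z z p N"
    using ex[of v] by blast
  have conv: "conv_at_inf z (\<lambda>j. F w1 w2 (Yo sV Y \<omega> sW act v j w)) (rat_fun z N p)"
    unfolding p(1) by (rule conv_at_inf_laurent_inf)
  show "YR_ser sV Y \<omega> sW act z v (F w1 w2) w = (\<lambda>n. F w1 (act2 v n w2) w)"
    unfolding p(2) by (rule YR_ser_eqI[OF z conv])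
  show "YL_ser sV Y \<omega> sW act z v (F w1 w2) w = (\<lambda>n. F (act1 v n w1) w2 w)"
    unfolding p(3) by (rule YL_ser_eqI[OF z conv])
qed

lemma VV_hom_to_D_imp:
  assumes V: "VOA sV Y vac \<omega>"
    and W: "weak_module sV Y vac s1 act1" "weak_module sV Y vac s2 act2" "weak_module sV Y vac sW act"
    and z: "z \<noteq> 0" and F: "bilinear_to_dual s1 s2 sW F"
    and H: "VV_hom_to_D sV Y \<omega> act1 act2 sW act z F"
  shows "YR_ser sV Y \<omega> sW act z v (F w1 w2) w k = F w1 (act2 v k w2) w"
    and "YL_ser sV Y \<omega> sW act z v (F w1 w2) w k = F (act1 v k w1) w2 w"
proof -
  note F0 = bilinear_to_dual_D[OF F]
  have "F w1 (act2 v k w2) w = (\<Sum>m\<in>{m. F (act1 vac m w1) (act2 v (k - m) w2) \<noteq> (\<lambda>_. 0)}.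
      F (act1 vac m w1) (act2 v (k - m) w2) w)"
    by (subst sum_single_support[where k = 0 and t = "\<lambda>m. F (act1 vac m w1) (act2 v (k - m) w2)"])
       (simp_all add: weak_module_D(5)[OF W(1)] F0)
  also have "\<dots> = YP_coef sV Y \<omega> sW act z vac v (F w1 w2) k w"
    using H unfolding VV_hom_to_D_def Let_def by blast
  also have "\<dots> = YR_ser sV Y \<omega> sW act z v (F w1 w2) w k"
  proof -
    \<comment> \<open>For j not 0 the j-th coefficient of Y^o(vac,x)w' is the zero vector, so the
      functional given by a coefficient of Y^R is needed at 0.\<close>
    have R0: "YR_ser sV Y \<omega> sW act z v (F w1 w2) 0 n = 0" for n
      using YRL_ser_delta(1)[OF z, of "F w1 w2" sV Y \<omega> sW act v 0 0]
      by (simp add: Yo_zero_right[OF W(3)] F0)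
    have L: "YL_ser sV Y \<omega> sW act z vac (\<lambda>w''. YR_ser sV Y \<omega> sW act z v (F w1 w2) w'' n) w'
        = (\<lambda>j. if j = 0 then YR_ser sV Y \<omega> sW act z v (F w1 w2) w' n else 0)" for n w'
      by (rule YRL_ser_delta(2)[OF z]) (simp add: Yo_vac[OF V W(3)] R0)
    show ?thesis unfolding YP_coef_def Let_def L
      by (subst sum_single_support[where k = 0 and
            t = "\<lambda>m w'. if m = 0 then YR_ser sV Y \<omega> sW act z v (F w1 w2) w' (k - m) else 0"]) auto
  qed
  finally show "YR_ser sV Y \<omega> sW act z v (F w1 w2) w k = F w1 (act2 v k w2) w" by simp
  have "F (act1 v k w1) w2 w = (\<Sum>m\<in>{m. F (act1 v m w1) (act2 vac (k - m) w2) \<noteq> (\<lambda>_. 0)}.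
      F (act1 v m w1) (act2 vac (k - m) w2) w)"
    by (subst sum_single_support[where k = k and t = "\<lambda>m. F (act1 v m w1) (act2 vac (k - m) w2)"])
       (simp_all add: weak_module_D(5)[OF W(2)] F0)
  also have "\<dots> = YP_coef sV Y \<omega> sW act z v vac (F w1 w2) k w"
    using H unfolding VV_hom_to_D_def Let_def by blast
  also have "\<dots> = YL_ser sV Y \<omega> sW act z v (F w1 w2) w k"
  proof -
    have R: "YR_ser sV Y \<omega> sW act z vac (F w1 w2) w' = (\<lambda>j. if j = 0 then F w1 w2 w' else 0)" for w'
      by (rule YRL_ser_delta(1)[OF z]) (simp add: Yo_vac[OF V W(3)] F0)
    \<comment> \<open>For m different from k the vacuum leaves the zero functional, whose Y^L series
      must vanish.\<close>
    have L0: "YL_ser sV Y \<omega> sW act z v (\<lambda>_. 0) w' n = 0" for w' n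
      using YRL_ser_delta(2)[OF z, of "\<lambda>_. 0" sV Y \<omega> sW act v w' 0] by simp
    show ?thesis unfolding YP_coef_def Let_def R
      by (subst sum_single_support[where k = k and
            t = "\<lambda>m w'. YL_ser sV Y \<omega> sW act z v (\<lambda>w''. if k - m = 0 then F w1 w2 w'' else 0) w' m"])
         (auto simp: L0)
  qed
  finally show "YL_ser sV Y \<omega> sW act z v (F w1 w2) w k = F (act1 v k w1) w2 w" by simp
qed

theorem theorem4p5:
  fixes sV :: "complex \<Rightarrow> 'v::ab_group_add \<Rightarrow> 'v"
    and Y :: "'v \<Rightarrow> int \<Rightarrow> 'v \<Rightarrow> 'v" and vac \<omega> :: 'v
    and s1 :: "complex \<Rightarrow> 'w1::ab_group_add \<Rightarrow> 'w1" and act1 :: "'v \<Rightarrow> int \<Rightarrow> 'w1 \<Rightarrow> 'w1"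
    and s2 :: "complex \<Rightarrow> 'w2::ab_group_add \<Rightarrow> 'w2" and act2 :: "'v \<Rightarrow> int \<Rightarrow> 'w2 \<Rightarrow> 'w2"
    and sW :: "complex \<Rightarrow> 'w::ab_group_add \<Rightarrow> 'w" and act :: "'v \<Rightarrow> int \<Rightarrow> 'w \<Rightarrow> 'w"
    and z :: complex and F :: "'w1 \<Rightarrow> 'w2 \<Rightarrow> 'w \<Rightarrow> complex"
  assumes "VOA sV Y vac \<omega>"
    and "gen_module sV Y vac \<omega> s1 act1"
    and "gen_module sV Y vac \<omega> s2 act2"
    and "gen_module sV Y vac \<omega> sW act"
    and "z \<noteq> 0"
    and "bilinear_to_dual s1 s2 sW F"
  shows "P_intertwining sV Y \<omega> s1 act1 s2 act2 sW act z F \<longleftrightarrow>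
           ((\<forall>w1 w2. F w1 w2 \<in> D_Pz sV Y \<omega> sW act z) \<and>
            VV_hom_to_D sV Y \<omega> act1 act2 sW act z F)"
proof -
  have W: "weak_module sV Y vac s1 act1" "weak_module sV Y vac s2 act2" "weak_module sV Y vac sW act"
    by (rule assms(2-4)[unfolded gen_module_def, THEN conjunct1])+
  note hyps = assms(1) W assms(5,6)
  show ?thesis
  proof (intro iffI conjI allI)
    fix w1 w2
    assume P: "P_intertwining sV Y \<omega> s1 act1 s2 act2 sW act z F"
    show "F w1 w2 \<in> D_Pz sV Y \<omega> sW act z"
      by (rule P_intertwining_imp(1)[OF hyps P])
  next
    assume P: "P_intertwining sV Y \<omega> s1 act1 s2 act2 sW act z F"
    show "VV_hom_to_D sV Y \<omega> act1 act2 sW act z F"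
      \<comment> \<open>The coefficient of Y^R is \<open>F w1 (act2 v (k - m) w2)\<close>, again a
        value of \<open>F\<close>, so the formula for Y^L applies to it and both sides become the
        same sum.\<close>
      unfolding VV_hom_to_D_def YP_coef_def by (simp add: P_intertwining_imp(2,3)[OF hyps P])
  next
    assume R: "(\<forall>w1 w2. F w1 w2 \<in> D_Pz sV Y \<omega> sW act z) \<and> VV_hom_to_D sV Y \<omega> act1 act2 sW act z F"
    show "P_intertwining sV Y \<omega> s1 act1 s2 act2 sW act z F"
      unfolding P_intertwining_iff
    proof (intro allI)
      fix v w1 w2 w
      \<comment> \<open>One rational function serves all three series: the first is its expansion at
        infinity by uniqueness, and the homomorphism property identifies the other two with Y^R and
        Y^L, its expansions at 0 and z.\<close>
      obtain N p where conv: "conv_at_inf z (\<lambda>j. F w1 w2 (Yo sV Y \<omega> sW act v j w)) (rat_fun z N p)"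
        using R unfolding D_Pz_def by blast
      have "(\<lambda>j. F w1 w2 (Yo sV Y \<omega> sW act v j w)) = laurent_inf z p N"
        using conv_at_inf_unique[OF conv conv_at_inf_laurent_inf] .
      moreover have "(\<lambda>n. F w1 (act2 v n w2) w) = laurent_zero z p N"
        by (simp flip: VV_hom_to_D_imp(1)[OF hyps conjunct2[OF R]] add: YR_ser_eqI[OF assms(5) conv])
      moreover have "(\<lambda>n. F (act1 v n w1) w2 w) = laurent_z z p N"
        by (simp flip: VV_hom_to_D_imp(2)[OF hyps conjunct2[OF R]] add: YL_ser_eqI[OF assms(5) conv])
      ultimately show "delta_identity z (\<lambda>j. F w1 w2 (Yo sV Y \<omega> sW act v j w))
          (\<lambda>n. F w1 (act2 v n w2) w) (\<lambda>n. F (act1 v n w1) w2 w)"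
        using delta_identity_laurent[OF assms(5)] by simp
    qed
  qed
qed

end
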